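(* There is a probability measure $\hat\mu$ on $[0,1]^2$, mutually absolutely continuous with respect to Lebesgue measure on $[0,1]^2$, such that $\hat T_{fast}$ preserves $\hat\mu$ and is ergodic with respect to $\hat\mu$.
   Context: $T(x)=\frac1x-\lfloor\frac1x\rfloor$ denotes the Gauss map. For $(x,y)\in[0,1]^2$ (defined up to a Lebesgue-null set, which is irrelevant here), $$\hat T_{slow}(x,y)=\begin{cases}\left(T(1-x),\frac{y}{1-x}\right), & 0\le y\le 1-x,\\ \left(T(x),\frac{1-y}{x}\right), & 1-x\le y\le 1.\end{cases}$$ Let $F=\{(x,y)\in[0,1]^2: y\ge 1-x \text{ or } x>1/2\}$, let $N_F(x,y)=\min\{n\ge 0:\hat T_{slow}^n(x,y)\in F\}$ (finite for almost every $(x,y)$), and define $\hat T_{fast}(x,y)=\hat T_{slow}^{N_F(x,y)+1}(x,y)$. *)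

theory Defs
  imports "HOL-Analysis.Analysis" "HOL-Probability.Probability"
begin

definition gauss_map :: "real \<Rightarrow> real" where
  "gauss_map x = 1 / x - of_int \<lfloor>1 / x\<rfloor>"

definition unit_square :: "(real \<times> real) set" where
  "unit_square = {0..1} \<times> {0..1}"

text \<open>On the overlap \<open>y = 1 - x\<close> of the two branches the first one is used. Since \<open>t / 0 = 0\<close>,
  the map is total and sends the closed unit square to itself.\<close>

definition T_slow :: "real \<times> real \<Rightarrow> real \<times> real" where
  "T_slow = (\<lambda>(x, y).
     if y \<le> 1 - x then (gauss_map (1 - x), y / (1 - x))
     else (gauss_map x, (1 - y) / x))"

definition F_set :: "(real \<times> real) set" where
  "F_set = {(x, y) \<in> unit_square. y \<ge> 1 - x \<or> x > 1 / 2}"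

text \<open>Points of the square that never reach \<open>F_set\<close> have \<open>x = 0\<close> or \<open>x = 1 / k\<close> for some \<open>k \<ge> 2\<close> (a null set);
  for them \<open>LEAST\<close> is a fixed unspecified number.\<close>

definition hit_time_F :: "real \<times> real \<Rightarrow> nat" where
  "hit_time_F z = (LEAST n. (T_slow ^^ n) z \<in> F_set)"

definition T_fast :: "real \<times> real \<Rightarrow> real \<times> real" where
  "T_fast z = (T_slow ^^ (hit_time_F z + 1)) z"

definition lebesgue_square :: "(real \<times> real) measure" where
  "lebesgue_square = restrict_space lborel unit_square"

definition preserves_measure :: "('a \<Rightarrow> 'a) \<Rightarrow> 'a measure \<Rightarrow> bool" where
  "preserves_measure T M \<longleftrightarrow>
     T \<in> measurable M M \<and>
     (\<forall>A\<in>sets M. emeasure M (T -` A \<inter> space M) = emeasure M A)"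

definition ergodic_wrt :: "('a \<Rightarrow> 'a) \<Rightarrow> 'a measure \<Rightarrow> bool" where
  "ergodic_wrt T M \<longleftrightarrow>
     (\<forall>A\<in>sets M. T -` A \<inter> space M = A \<longrightarrow> A \<in> null_sets M \<or> space M - A \<in> null_sets M)"

end

theory Submission
  imports Defs
begin

text \<open>
Let \<open>G\<close> be the Gauss map. Following the slow orbit shows that \<open>T_fast\<close> consumes one or two continued
fraction digits of \<open>x\<close>: with \<open>a = \<lfloor>1 / x\<rfloor>\<close>, a point \<open>(x, y)\<close> goes to
\<open>(G x, (1 - y) / x - \<lfloor>(1 - y) / x\<rfloor>)\<close> if \<open>y > 1 - a x\<close>, and to \<open>(G (G x), y / (1 - a x))\<close> if
\<open>y < 1 - a x\<close>. Thus \<open>T_fast\<close> has countably many branches, each of which maps its domain onto the whole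
open square and has a projective inverse whose Jacobian depends on the first coordinate only
(\<open>T_fast_inv_branch\<close>).

Everything is expressed through the transfer operator, the sum over the inverse branches weighted by
their Jacobians. It preserves integrals over the square (\<open>nn_integral_transfer\<close>), and it is dual to
composition with \<open>T_fast\<close> (\<open>nn_integral_koopman\<close>). It fixes the function
\<open>1 / (1 + x) + 1 / (1 + x)\<^sup>2\<close> (\<open>transfer_inv_density\<close>), by an identity between telescoping series.
Normalised, this function is the density of the invariant measure; it lies between \<open>3 / 4\<close> and \<open>2\<close>
before normalisation, so that the measure is equivalent to Lebesgue measure.

Ergodicity is a Renyi type argument. Two consecutive inverse branches contract a suitable metric by
the factor 2 (\<open>two_step_contraction\<close>), and the logarithm of a Jacobian is Lipschitz with a constant
that is the same for all branches (\<open>jacobian_ratio\<close>). So high iterates of the transfer operator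
compare any two points of the square up to the factor \<open>exp 8\<close> (\<open>dominates_transfer_twice\<close>). It
follows that an invariant set \<open>A\<close> meets every neighbourhood of a compact set \<open>K\<close> in measure at least
\<open>exp (- 8)\<close> times the product of the measures of \<open>A\<close> and \<open>K\<close> (\<open>invariant_mixing_bound\<close>). If the complement of \<open>A\<close> had
positive measure, approximating it by compact sets from inside and by open sets from outside would
contradict this, unless \<open>A\<close> is null (\<open>invariant_set_trivial\<close>).
\<close>

section \<open>The fast map and its inverse branches\<close>

text \<open>The inverse branches of \<open>T_fast\<close>. Write \<open>a = \<lfloor>1 / x\<rfloor>\<close> and let \<open>G\<close> be the Gauss map. As long as
\<open>x < 1 / 2\<close> and \<open>y < 1 - x\<close>, a slow step is \<open>(x, y) \<mapsto> (x / (1 - x), y / (1 - x))\<close>, which lowers \<open>1 / x\<close> and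
\<open>(1 - y) / x\<close> by one. Hence a point with \<open>y > 1 - a x\<close> ends at \<open>(G x, (1 - y) / x - j)\<close> with \<open>j < a\<close> the
integer part of \<open>(1 - y) / x\<close>: one digit \<open>a\<close> of the continued fraction of \<open>x\<close> is consumed
(\<open>Single a j\<close>). A point with \<open>y < 1 - a x\<close> runs until \<open>x > 1 / 2\<close> and ends at
\<open>(G (G x), y / (1 - a x))\<close>: the two digits \<open>a\<close>, \<open>b\<close> are consumed (\<open>Double a b\<close>).\<close>

datatype branch = Single nat nat | Double nat nat

fun admissible :: "branch \<Rightarrow> bool" where
  "admissible (Single a j) \<longleftrightarrow> j < a"
| "admissible (Double a b) \<longleftrightarrow> 1 \<le> a \<and> 1 \<le> b"

text \<open>Each inverse branch is a projective map with denominator \<open>denom i u\<close>; in the plane its Jacobian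
determinant is therefore \<open>1 / denom i u ^ 3\<close>.\<close>

fun denom :: "branch \<Rightarrow> real \<Rightarrow> real" where
  "denom (Single a j) u = real a + u"
| "denom (Double a b) u = real a * (real b + u) + 1"

fun inv_branch :: "branch \<Rightarrow> real \<times> real \<Rightarrow> real \<times> real" where
  "inv_branch (Single a j) (u, v) = (1 / (real a + u), 1 - (real j + v) / (real a + u))"
| "inv_branch (Double a b) (u, v) =
     ((real b + u) / (real a * (real b + u) + 1), v / (real a * (real b + u) + 1))"

abbreviation open_square :: "(real \<times> real) set" where
  "open_square \<equiv> {0<..<1} \<times> {0<..<1}"

lemma inv_branch_in_open_square:
  assumes "admissible i" "z \<in> open_square"
  shows "inv_branch i z \<in> open_square"
proof -
  obtain u v where z: "z = (u, v)" "0 < u" "u < 1" "0 < v" "v < 1" using assms by auto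
  show ?thesis
  proof (cases i)
    case (Single a j)
    then have "real j + 1 \<le> real a" using assms by (simp flip: of_nat_Suc)
    then show ?thesis using z Single by (auto simp: field_simps)
  next
    case (Double a b)
    then have a: "1 \<le> real a" and b: "1 \<le> real b" using assms by auto
    then have "0 < real a * (real b + u)" "1 * (real b + u) \<le> real a * (real b + u)"
      using z by (auto intro!: mult_pos_pos mult_right_mono)
    then show ?thesis using z Double b by (auto simp: field_simps)
  qed
qed

lemma gauss_map_unique:
  assumes "1 / x = of_int k + r" "0 \<le> r" "r < 1"
  shows "gauss_map x = r"
proof -
  have "\<lfloor>1 / x\<rfloor> = k" using assms by (intro floor_unique) auto
  then show ?thesis using assms by (simp add: gauss_map_def)
qed

lemma T_slow_step:
  assumes "0 < x" "x < 1 / 2" "y \<le> 1 - x"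
  shows "T_slow (x, y) = (x / (1 - x), y / (1 - x))"
proof -
  have "gauss_map (1 - x) = x / (1 - x)"
    by (rule gauss_map_unique[where k = 1]) (use assms in \<open>auto simp: field_simps\<close>)
  then show ?thesis using assms by (simp add: T_slow_def)
qed

lemma T_fast_hit:
  assumes "p \<in> F_set"
  shows "T_fast p = T_slow p"
proof -
  have "hit_time_F p = 0" unfolding hit_time_F_def using assms by (intro Least_eq_0) simp
  then show ?thesis by (simp add: T_fast_def)
qed

text \<open>\<open>hit_time_F\<close> is unspecified on orbits that never meet \<open>F_set\<close>, so the recursion for \<open>T_fast\<close> along a
slow orbit needs to know that the orbit does meet it.\<close>

definition reaches_F :: "real \<times> real \<Rightarrow> bool" where
  "reaches_F p \<longleftrightarrow> (\<exists>n. (T_slow ^^ n) p \<in> F_set)"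

lemma T_fast_miss:
  assumes "p \<notin> F_set" "reaches_F (T_slow p)"
  shows "reaches_F p" "T_fast p = T_fast (T_slow p)"
proof -
  obtain n where "(T_slow ^^ n) (T_slow p) \<in> F_set" using assms by (auto simp: reaches_F_def)
  then have n: "(T_slow ^^ Suc n) p \<in> F_set" by (simp add: funpow_swap1)
  then show "reaches_F p" unfolding reaches_F_def by blast
  have "hit_time_F p = Suc (LEAST n. (T_slow ^^ Suc n) p \<in> F_set)"
    unfolding hit_time_F_def by (rule Least_Suc[where P = "\<lambda>n. (T_slow ^^ n) p \<in> F_set", OF n]) (use assms in simp)
  also have "(LEAST n. (T_slow ^^ Suc n) p \<in> F_set) = hit_time_F (T_slow p)"
    by (simp add: hit_time_F_def funpow_swap1)
  finally show "T_fast p = T_fast (T_slow p)" by (simp add: T_fast_def funpow_swap1)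
qed

text \<open>A slow step outside \<open>F_set\<close> turns \<open>Single (a + 1) (j + 1)\<close> into \<open>Single a j\<close>, and the points of
\<open>Single a 0\<close> lie in \<open>F_set\<close> because there \<open>y > 1 - x\<close>.\<close>

lemma T_fast_Single:
  assumes "0 < u" "u < 1" "0 < v" "v < 1" "j < a"
  shows "reaches_F (inv_branch (Single a j) (u, v)) \<and> T_fast (inv_branch (Single a j) (u, v)) = (u, v)"
  using assms(5)
proof (induction j arbitrary: a)
  case 0
  let ?p = "inv_branch (Single a 0) (u, v)"
  have Q: "?p \<in> open_square" using assms 0 by (intro inv_branch_in_open_square) auto
  have "v / (real a + u) \<le> 1 / (real a + u)" using assms by (intro divide_right_mono) auto
  then have F: "?p \<in> F_set" using Q by (auto simp: F_set_def unit_square_def)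
  have "gauss_map (1 / (real a + u)) = u"
    by (rule gauss_map_unique[where k = "int a"]) (use assms in auto)
  moreover have "\<not> 1 - v / (real a + u) \<le> 1 - 1 / (real a + u)"
    using assms 0 by (simp add: divide_less_cancel not_le divide_strict_right_mono)
  ultimately have "T_slow ?p = (u, v)" using assms 0 by (simp add: T_slow_def)
  moreover have "reaches_F ?p" unfolding reaches_F_def using F by (intro exI[of _ 0]) simp
  ultimately show ?case using T_fast_hit[OF F] by simp
next
  case (Suc j)
  then obtain b where a: "a = Suc b" and jb: "j < b" by (cases a) auto
  let ?p = "inv_branch (Single a (Suc j)) (u, v)"
  define D where "D = real b + u"
  have D: "D > 1" using jb assms by (simp add: D_def)
  have p: "?p = (1 / (D + 1), 1 - (real j + 1 + v) / (D + 1))" by (simp add: a D_def algebra_simps)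
  have lt: "1 / (D + 1) < (real j + 1 + v) / (D + 1)"
    using D assms by (intro divide_strict_right_mono) auto
  have half: "1 / (D + 1) < 1 / 2" using D by (simp add: field_simps)
  have F: "?p \<notin> F_set" unfolding p using lt half by (auto simp: F_set_def)
  have e: "1 - 1 / (D + 1) = D / (D + 1)" using D by (simp add: field_simps)
  have "T_slow ?p = (1 / (D + 1) / (D / (D + 1)), (1 - (real j + 1 + v) / (D + 1)) / (D / (D + 1)))"
    unfolding p e[symmetric] by (rule T_slow_step) (use D lt half in auto)
  also have "\<dots> = inv_branch (Single b j) (u, v)"
    unfolding inv_branch.simps D_def[symmetric] using D by (auto simp: divide_simps) (simp_all add: algebra_simps)?
  finally have "T_slow ?p = inv_branch (Single b j) (u, v)" .
  then show ?case using Suc.IH[OF jb] T_fast_miss[OF F] by simp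
qed

text \<open>A slow step outside \<open>F_set\<close> turns \<open>Double (a + 1) b\<close> into \<open>Double a b\<close>, and the points of
\<open>Double 1 b\<close> lie in \<open>F_set\<close> because there \<open>x > 1 / 2\<close>.\<close>

lemma T_fast_Double:
  assumes "0 < u" "u < 1" "0 < v" "v < 1" "1 \<le> a" "1 \<le> b"
  shows "reaches_F (inv_branch (Double a b) (u, v)) \<and> T_fast (inv_branch (Double a b) (u, v)) = (u, v)"
  using assms(5)
proof (induction a rule: dec_induct)
  case base
  let ?p = "inv_branch (Double 1 b) (u, v)"
  define w where "w = real b + u"
  have w: "w > 1" using assms by (simp add: w_def)
  have p: "?p = (w / (w + 1), v / (w + 1))" by (simp add: w_def)
  have Q: "?p \<in> open_square" using assms by (intro inv_branch_in_open_square) auto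
  have F: "?p \<in> F_set" using Q w unfolding p by (auto simp: F_set_def unit_square_def field_simps)
  have e: "1 - w / (w + 1) = 1 / (w + 1)" using w by (simp add: field_simps)
  have "gauss_map (1 / (w + 1)) = u"
    by (rule gauss_map_unique[where k = "int b + 1"]) (use assms in \<open>auto simp: w_def\<close>)
  moreover have "v / (w + 1) \<le> 1 / (w + 1)" using assms w by (intro divide_right_mono) auto
  ultimately have "T_slow ?p = (u, v)" unfolding p T_slow_def using w by (simp add: e)
  moreover have "reaches_F ?p" unfolding reaches_F_def using F by (intro exI[of _ 0]) simp
  ultimately show ?case using T_fast_hit[OF F] by simp
next
  case (step a)
  let ?p = "inv_branch (Double (Suc a) b) (u, v)"
  define w where "w = real b + u"
  have w: "w > 1" using assms by (simp add: w_def)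
  define D where "D = real a * w + 1"
  have "1 * w \<le> real a * w" using step w by (intro mult_right_mono) auto
  then have D: "D \<ge> 1 + w" by (simp add: D_def)
  have p: "?p = (w / (D + w), v / (D + w))" by (simp add: w_def D_def algebra_simps)
  have e: "1 - w / (D + w) = D / (D + w)" using D w by (simp add: field_simps)
  have lt: "v / (D + w) < D / (D + w)" using D w assms by (intro divide_strict_right_mono) auto
  have half: "w / (D + w) < 1 / 2" using D w by (simp add: field_simps)
  have F: "?p \<notin> F_set" unfolding p using lt half e by (auto simp: F_set_def)
  have "T_slow ?p = (w / (D + w) / (D / (D + w)), v / (D + w) / (D / (D + w)))"
    unfolding p e[symmetric] by (rule T_slow_step) (use D w lt half e in auto)
  also have "\<dots> = inv_branch (Double a b) (u, v)"
    unfolding inv_branch.simps w_def[symmetric] D_def[symmetric] using D w by simp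
  finally have "T_slow ?p = inv_branch (Double a b) (u, v)" .
  then show ?case using step.IH T_fast_miss[OF F] by simp
qed

text \<open>All branches are full, and there is no exceptional null set inside the open square, so that null sets
enter the argument only through the boundary of the square.\<close>

lemma T_fast_inv_branch:
  assumes "admissible i" "z \<in> open_square"
  shows "T_fast (inv_branch i z) = z"
  using assms T_fast_Single T_fast_Double by (cases i; cases z) auto

section \<open>The fast map as a measurable self-map of the square\<close>

text \<open>The convention \<open>t / 0 = 0\<close> makes this true on the whole boundary as well; it is needed because
preservation of a measure includes measurability as a self-map of the closed square.\<close>

lemma T_slow_in_unit_square:
  assumes "z \<in> unit_square"
  shows "T_slow z \<in> unit_square"
proof -
  have g: "0 \<le> gauss_map x \<and> gauss_map x \<le> 1" for x
    unfolding gauss_map_def by linarith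
  obtain x y where z: "z = (x, y)" "0 \<le> x" "x \<le> 1" "0 \<le> y" "y \<le> 1"
    using assms by (auto simp: unit_square_def)
  show ?thesis
  proof (cases "y \<le> 1 - x")
    case True
    then have "y / (1 - x) \<in> {0..1}" using z by (cases "x = 1") (auto simp: field_simps)
    then show ?thesis using True z g by (auto simp: T_slow_def unit_square_def)
  next
    case False
    then have "(1 - y) / x \<in> {0..1}" using z by (auto simp: field_simps)
    then show ?thesis using False z g by (auto simp: T_slow_def unit_square_def)
  qed
qed

lemma unit_square_sets [measurable]: "unit_square \<in> sets borel"
  unfolding unit_square_def by (intro borel_closed closed_Times) auto

lemma gauss_map_measurable [measurable]: "gauss_map \<in> borel_measurable borel"
  unfolding gauss_map_def[abs_def] by measurable

lemma T_slow_measurable [measurable]: "T_slow \<in> borel_measurable borel"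
  unfolding T_slow_def borel_prod[symmetric] by measurable

lemma T_slow_power_measurable [measurable]: "(T_slow ^^ n) \<in> borel_measurable borel"
  by (induction n) auto

lemma F_set_sets [measurable]: "F_set \<in> sets borel"
proof -
  have "F_set = unit_square \<inter> {z. snd z \<ge> 1 - fst z \<or> fst z > 1 / 2}"
    by (auto simp: F_set_def)
  also have "{z :: real \<times> real. snd z \<ge> 1 - fst z \<or> fst z > 1 / 2} \<in> sets borel"
  proof -
    have [measurable]: "fst \<in> borel_measurable (borel :: (real \<times> real) measure)"
      "snd \<in> borel_measurable (borel :: (real \<times> real) measure)"
      by (rule borel_measurable_continuous_onI, intro continuous_intros)+
    have "Measurable.pred borel (\<lambda>z :: real \<times> real. snd z \<ge> 1 - fst z \<or> fst z > 1 / 2)"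
      by measurable
    then show ?thesis by (simp add: pred_def)
  qed
  then have "unit_square \<inter> {z. snd z \<ge> 1 - fst z \<or> fst z > 1 / 2} \<in> sets borel" by auto
  finally show ?thesis .
qed

lemma T_fast_measurable [measurable]: "T_fast \<in> borel_measurable borel"
proof -
  have "hit_time_F \<in> measurable borel (count_space UNIV)"
    unfolding hit_time_F_def[abs_def] by measurable
  then have "(\<lambda>z. (T_slow ^^ (hit_time_F z + 1)) z) \<in> borel_measurable borel"
    by (rule measurable_compose_countable[where f = "\<lambda>n. T_slow ^^ (n + 1)",
          OF T_slow_power_measurable])
  then show ?thesis unfolding T_fast_def[abs_def] .
qed

lemma T_fast_in_unit_square:
  assumes "z \<in> unit_square"
  shows "T_fast z \<in> unit_square"
proof -
  have "(T_slow ^^ n) z \<in> unit_square" for n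
    by (induction n) (auto simp: assms T_slow_in_unit_square)
  then show ?thesis unfolding T_fast_def by blast
qed

section \<open>Substitution under one-dimensional integrals\<close>

lemma nn_integral_gauss_branch:
  fixes g :: "real \<Rightarrow> ennreal" and a :: real
  assumes [measurable]: "g \<in> borel_measurable borel" and a: "1 \<le> a"
  shows "(\<integral>\<^sup>+x. g x * indicator {1 / (a + 1)<..1 / a} x \<partial>lborel) =
    (\<integral>\<^sup>+u. g (1 / (a + u)) * ennreal (1 / (a + u)^2) * indicator {0<..<1} u \<partial>lborel)"
proof -
  \<comment> \<open>The map \<open>u \<mapsto> 1 / (a + u)\<close> is decreasing, so the substitution is made in \<open>t = 1 - u\<close>.\<close>
  have "(\<integral>\<^sup>+x. g x * indicator {1 / (a + 1)<..1 / a} x \<partial>lborel) =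
      (\<integral>\<^sup>+x. g x * indicator {1 / (a + 1 - 0)..1 / (a + 1 - 1)} x \<partial>lborel)"
    by (intro nn_integral_cong_AE, rule AE_mp[OF AE_lborel_singleton[of "1 / (a + 1)"]])
      (auto split: split_indicator)
  also have "\<dots> = (\<integral>\<^sup>+t. g (1 / (a + 1 - t)) * ennreal (1 / (a + 1 - t)^2) * indicator {0..1} t \<partial>lborel)"
    by (rule nn_integral_substitution_aux)
      (use a in \<open>auto intro!: derivative_eq_intros continuous_intros simp: power2_eq_square\<close>)
  also have "\<dots> = (\<integral>\<^sup>+u. g (1 / (a + u)) * ennreal (1 / (a + u)^2) * indicator {0..1} u \<partial>lborel)"
    by (subst nn_integral_real_affine[of _ "-1" 1])
      (auto intro!: nn_integral_cong split: split_indicator)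
  also have "\<dots> = (\<integral>\<^sup>+u. g (1 / (a + u)) * ennreal (1 / (a + u)^2) * indicator {0<..<1} u \<partial>lborel)"
    by (intro nn_integral_cong_AE, rule AE_mp[OF AE_lborel_singleton[of 0]],
        rule AE_mp[OF AE_lborel_singleton[of 1]]) (auto split: split_indicator)
  finally show ?thesis .
qed

lemma nn_integral_gauss:
  fixes g :: "real \<Rightarrow> ennreal"
  assumes [measurable]: "g \<in> borel_measurable borel"
  shows "(\<integral>\<^sup>+x. g x * indicator {0<..<1} x \<partial>lborel) =
    (\<Sum>n. \<integral>\<^sup>+u. g (1 / (real (Suc n) + u)) * ennreal (1 / (real (Suc n) + u)^2) * indicator {0<..<1} u \<partial>lborel)"
proof -
  define I where "I n = {1 / (real (Suc n) + 1)<..1 / real (Suc n)}" for n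
  have mem: "x \<in> I n \<longleftrightarrow> x > 0 \<and> \<lfloor>1 / x\<rfloor> = int (Suc n)" for x n
  proof (cases "x > 0")
    case True
    then have "x \<in> I n \<longleftrightarrow> real (Suc n) \<le> 1 / x \<and> 1 / x < real (Suc n) + 1"
      by (auto simp: I_def field_simps)
    then show ?thesis using True by (simp add: floor_eq_iff)
  next
    case False
    moreover have "0 < 1 / (real (Suc n) + 1)" by simp
    ultimately have "x \<notin> I n" unfolding I_def by (metis greaterThanAtMost_iff less_trans)
    then show ?thesis using False by blast
  qed
  have disj: "disjoint_family I"
    unfolding disjoint_family_on_def by (auto simp: mem)
  have un: "(\<Union>n. I n) = {0<..1}"
  proof (intro equalityI subsetI)
    fix x assume "x \<in> (\<Union>n. I n)"
    then obtain n where n: "x > 0" "\<lfloor>1 / x\<rfloor> = int (Suc n)" by (auto simp: mem)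
    then have "1 \<le> 1 / x" by linarith
    then show "x \<in> {0<..1}" using n by (auto simp: field_simps)
  next
    fix x :: real assume x: "x \<in> {0<..1}"
    then have "1 \<le> \<lfloor>1 / x\<rfloor>" by (auto simp: field_simps le_floor_iff)
    then have "x \<in> I (nat (\<lfloor>1 / x\<rfloor> - 1))" using x by (simp add: mem)
    then show "x \<in> (\<Union>n. I n)" by blast
  qed
  have "(\<integral>\<^sup>+x. g x * indicator {0<..<1} x \<partial>lborel) = (\<integral>\<^sup>+x. g x * indicator (\<Union>n. I n) x \<partial>lborel)"
    unfolding un
    by (intro nn_integral_cong_AE, rule AE_mp[OF AE_lborel_singleton[of 1]]) (auto split: split_indicator)
  also have "\<dots> = (\<Sum>n. \<integral>\<^sup>+x. g x * indicator (I n) x \<partial>lborel)"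
    by (rule nn_integral_disjoint_family[OF _ _ disj]) (auto simp: I_def)
  also have "\<dots> = (\<Sum>n. \<integral>\<^sup>+u. g (1 / (real (Suc n) + u)) * ennreal (1 / (real (Suc n) + u)^2) * indicator {0<..<1} u \<partial>lborel)"
    unfolding I_def by (intro suminf_cong nn_integral_gauss_branch) auto
  finally show ?thesis .
qed

lemma nn_integral_affine_unit:
  fixes g :: "real \<Rightarrow> ennreal" and r s :: real
  assumes [measurable]: "g \<in> borel_measurable borel" and s: "s > 0"
  shows "(\<integral>\<^sup>+y. g y * indicator {r<..<r + s} y \<partial>lborel) =
    ennreal s * (\<integral>\<^sup>+v. g (r + s * v) * indicator {0<..<1} v \<partial>lborel)"
  by (subst nn_integral_real_affine[of _ s r])
    (use s in \<open>auto intro!: arg_cong2[where f = times] nn_integral_cong split: split_indicator simp: mult_less_cancel_left1 zero_less_mult_iff\<close>)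

text \<open>For \<open>1 / (a + 1) < x < 1 / a\<close> this is how the vertical fibre over \<open>x\<close> is cut by the branches: one
piece below the height \<open>1 - a x\<close>, belonging to the branches \<open>Double a b\<close>, and above it \<open>a\<close> strips of
width \<open>x\<close>, belonging to the branches \<open>Single a j\<close>.\<close>

lemma nn_integral_strips:
  fixes g :: "real \<Rightarrow> ennreal" and x :: real
  assumes [measurable]: "g \<in> borel_measurable borel" and x: "x > 0" "real a * x < 1"
  shows "(\<integral>\<^sup>+y. g y * indicator {0<..<1} y \<partial>lborel) =
    ennreal (1 - real a * x) * (\<integral>\<^sup>+v. g (v * (1 - real a * x)) * indicator {0<..<1} v \<partial>lborel) +
    (\<Sum>j<a. ennreal x * (\<integral>\<^sup>+v. g (1 - (real j + v) * x) * indicator {0<..<1} v \<partial>lborel))"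
proof -
  have "(\<integral>\<^sup>+y. g y * indicator {0<..<1} y \<partial>lborel) =
      (\<integral>\<^sup>+y. g y * indicator {0<..<1 - real a * x} y \<partial>lborel) +
      (\<Sum>j<a. ennreal x * (\<integral>\<^sup>+v. g (1 - (real j + v) * x) * indicator {0<..<1} v \<partial>lborel))"
    using x(2)
  proof (induction a)
    case (Suc a)
    let ?s = "1 - real (Suc a) * x"
    have le: "real a * x < 1" "0 < ?s" using Suc.prems x by (auto simp: algebra_simps)
    have "(\<integral>\<^sup>+y. g y * indicator {0<..<1 - real a * x} y \<partial>lborel) =
        (\<integral>\<^sup>+y. g y * indicator {0<..<?s} y + g y * indicator {?s<..<?s + x} y \<partial>lborel)"
      by (intro nn_integral_cong_AE, rule AE_mp[OF AE_lborel_singleton[of ?s]])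
        (use le x in \<open>auto split: split_indicator simp: algebra_simps\<close>)
    also have "\<dots> = (\<integral>\<^sup>+y. g y * indicator {0<..<?s} y \<partial>lborel) + (\<integral>\<^sup>+y. g y * indicator {?s<..<?s + x} y \<partial>lborel)"
      by (intro nn_integral_add) auto
    also have "(\<integral>\<^sup>+y. g y * indicator {?s<..<?s + x} y \<partial>lborel) =
        ennreal x * (\<integral>\<^sup>+v. g (?s + x * v) * indicator {0<..<1} v \<partial>lborel)"
      by (rule nn_integral_affine_unit) (use x in auto)
    also have "(\<integral>\<^sup>+v. g (?s + x * v) * indicator {0<..<1} v \<partial>lborel) =
        (\<integral>\<^sup>+v. g (1 - (real a + v) * x) * indicator {0<..<1} v \<partial>lborel)"
      (is "?l = _")
    proof -
      have "?l = (\<integral>\<^sup>+v. g (?s + x * (1 - v)) * indicator {0<..<1} (1 - v) \<partial>lborel)"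
        by (subst nn_integral_real_affine[of _ "-1" 1]) (auto simp: algebra_simps)
      also have "\<dots> = (\<integral>\<^sup>+v. g (1 - (real a + v) * x) * indicator {0<..<1} v \<partial>lborel)"
        by (intro nn_integral_cong) (auto split: split_indicator simp: algebra_simps)
      finally show ?thesis .
    qed
    finally show ?case using Suc.IH[OF le(1)] by (simp add: ac_simps)
  qed simp
  also have "(\<integral>\<^sup>+y. g y * indicator {0<..<1 - real a * x} y \<partial>lborel) =
      ennreal (1 - real a * x) * (\<integral>\<^sup>+v. g (v * (1 - real a * x)) * indicator {0<..<1} v \<partial>lborel)"
    using nn_integral_affine_unit[of g "1 - real a * x" 0] x by (simp add: mult.commute)
  finally show ?thesis .
qed

section \<open>The transfer operator\<close>

definition branch_term :: "(real \<times> real \<Rightarrow> ennreal) \<Rightarrow> real \<times> real \<Rightarrow> branch \<Rightarrow> ennreal" where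
  "branch_term f z i = ennreal ((1 / denom i (fst z)) ^ 3) * f (inv_branch i z)"

text \<open>The Perron--Frobenius operator of \<open>T_fast\<close> with respect to Lebesgue measure. The digits run over
\<open>Suc n\<close> so that the sums are over all naturals; in the second sum the digit \<open>a = Suc m\<close> is the inner
index, because that is the order in which the invariant density telescopes.\<close>

definition transfer :: "(real \<times> real \<Rightarrow> ennreal) \<Rightarrow> real \<times> real \<Rightarrow> ennreal" where
  "transfer f z =
     (\<Sum>n. \<Sum>j<Suc n. branch_term f z (Single (Suc n) j)) +
     (\<Sum>n. \<Sum>m. branch_term f z (Double (Suc m) (Suc n)))"

lemma inv_branch_measurable [measurable]: "inv_branch i \<in> borel_measurable borel"
proof -
  have eq: "inv_branch i = (case i of
      Single a j \<Rightarrow> \<lambda>(u, v). (1 / (real a + u), 1 - (real j + v) / (real a + u))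
    | Double a b \<Rightarrow> \<lambda>(u, v). ((real b + u) / (real a * (real b + u) + 1), v / (real a * (real b + u) + 1)))"
    by (auto split: branch.split)
  show ?thesis unfolding eq borel_prod[symmetric] by (cases i) simp_all
qed

lemma denom_measurable [measurable]: "denom i \<in> borel_measurable borel"
proof -
  have eq: "denom i = (case i of
      Single a j \<Rightarrow> \<lambda>u. real a + u | Double a b \<Rightarrow> \<lambda>u. real a * (real b + u) + 1)"
    by (auto split: branch.split)
  show ?thesis unfolding eq by (cases i) simp_all
qed

lemma fst_borel_measurable [measurable]: "fst \<in> borel_measurable (borel :: (real \<times> real) measure)"
  by (rule borel_measurable_continuous_onI, intro continuous_intros)

lemma branch_term_measurable [measurable]:
  assumes [measurable]: "f \<in> borel_measurable borel"
  shows "(\<lambda>z. branch_term f z i) \<in> borel_measurable borel"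
  unfolding branch_term_def by measurable

lemma transfer_measurable [measurable]:
  assumes [measurable]: "f \<in> borel_measurable borel"
  shows "transfer f \<in> borel_measurable borel"
  unfolding transfer_def[abs_def] by measurable

lemma open_square_sets [measurable]: "open_square \<in> sets borel"
  by (intro borel_open open_Times) auto

lemma nn_integral_open_square:
  fixes f :: "real \<times> real \<Rightarrow> ennreal"
  assumes "f \<in> borel_measurable borel"
  shows "(\<integral>\<^sup>+z. f z * indicator open_square z \<partial>lborel) =
    (\<integral>\<^sup>+x. (\<integral>\<^sup>+y. f (x, y) * indicator {0<..<1} y \<partial>lborel) * indicator {0<..<1} x \<partial>lborel)"
proof -
  have [measurable]: "f \<in> borel_measurable (borel \<Otimes>\<^sub>M borel)" using assms by (simp add: borel_prod)
  have "(\<integral>\<^sup>+z. f z * indicator open_square z \<partial>lborel) =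
      (\<integral>\<^sup>+z. f z * indicator open_square z \<partial>(lborel \<Otimes>\<^sub>M lborel))" by (simp add: lborel_prod)
  also have "\<dots> = (\<integral>\<^sup>+x. \<integral>\<^sup>+y. f (x, y) * indicator open_square (x, y) \<partial>lborel \<partial>lborel)"
    by (subst lborel.nn_integral_fst[symmetric]) (auto simp: borel_prod)
  also have "\<dots> = (\<integral>\<^sup>+x. (\<integral>\<^sup>+y. f (x, y) * indicator {0<..<1} y \<partial>lborel) * indicator {0<..<1} x \<partial>lborel)"
    by (subst nn_integral_multc[symmetric])
      (auto simp: indicator_times ac_simps intro!: nn_integral_cong)
  finally show ?thesis .
qed

text \<open>This is the change of variables for all branches at once. The Gauss substitution \<open>x = 1 / (a + u)\<close>
and the fibre decomposition give the branches \<open>Single a j\<close>; the pieces below the height \<open>1 - a x\<close> are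
summed over \<open>a\<close> and substituted a second time, \<open>u = 1 / (b + u')\<close>, which gives \<open>Double a b\<close>.\<close>

lemma nn_integral_transfer:
  fixes f :: "real \<times> real \<Rightarrow> ennreal"
  assumes f [measurable]: "f \<in> borel_measurable borel"
  shows "(\<integral>\<^sup>+z. transfer f z * indicator open_square z \<partial>lborel) =
    (\<integral>\<^sup>+z. f z * indicator open_square z \<partial>lborel)"
proof -
  have f' [measurable]: "f \<in> borel_measurable (borel \<Otimes>\<^sub>M borel)" using f by (simp add: borel_prod)
  define W where "W i = (\<integral>\<^sup>+z. branch_term f z i * indicator open_square z \<partial>lborel)" for i
  have swap: "x * y * z = c * y" if "x * z = c" for x y z c :: ennreal
    unfolding that[symmetric] by (simp add: ac_simps)
  have W: "W i = (\<integral>\<^sup>+u. (\<integral>\<^sup>+v. branch_term f (u, v) i * indicator {0<..<1} v \<partial>lborel) *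
      indicator {0<..<1} u \<partial>lborel)" for i
    unfolding W_def by (rule nn_integral_open_square) measurable
  have bt [measurable]: "(\<lambda>(u, v). branch_term f (u, v) i) \<in> borel_measurable (borel \<Otimes>\<^sub>M borel)" for i
    using branch_term_measurable[OF f, of i] by (simp add: borel_prod split_beta')
  define F where "F x = (\<integral>\<^sup>+y. f (x, y) * indicator {0<..<1} y \<partial>lborel)" for x
  have [measurable]: "F \<in> borel_measurable borel" unfolding F_def[abs_def] by measurable
  \<comment> \<open>The part of the integral below the line \<open>y = 1 - a x\<close> after the first substitution, with \<open>a = Suc n\<close>.\<close>
  define H where "H n u = ennreal (u / (real (Suc n) + u) ^ 3) *
      (\<integral>\<^sup>+v. f (1 / (real (Suc n) + u), v * (u / (real (Suc n) + u))) * indicator {0<..<1} v \<partial>lborel)" for n u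
  have [measurable]: "H n \<in> borel_measurable borel" for n unfolding H_def[abs_def] by measurable
  have single: "(\<integral>\<^sup>+u. F (1 / (real (Suc n) + u)) * ennreal (1 / (real (Suc n) + u)^2) * indicator {0<..<1} u \<partial>lborel) =
      (\<integral>\<^sup>+u. H n u * indicator {0<..<1} u \<partial>lborel) + (\<Sum>j<Suc n. W (Single (Suc n) j))" for n
  proof -
    have pt: "F (1 / (real (Suc n) + u)) * ennreal (1 / (real (Suc n) + u)^2) =
        H n u + (\<Sum>j<Suc n. \<integral>\<^sup>+v. branch_term f (u, v) (Single (Suc n) j) * indicator {0<..<1} v \<partial>lborel)"
      if u: "0 < u" "u < 1" for u
    proof -
      define D where "D = real (Suc n) + u"
      have D: "D > 0" using u by (simp add: D_def)
      have e: "1 - real (Suc n) * (1 / D) = u / D" using D by (simp add: D_def field_simps)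
      define G where "G = (\<integral>\<^sup>+v. f (1 / D, v * (u / D)) * indicator {0<..<1} v \<partial>lborel)"
      define K where "K j = (\<integral>\<^sup>+v. f (1 / D, 1 - (real j + v) * (1 / D)) * indicator {0<..<1} v \<partial>lborel)" for j
      define V where "V j = (\<integral>\<^sup>+v. branch_term f (u, v) (Single (Suc n) j) * indicator {0<..<1} v \<partial>lborel)" for j
      have "real (Suc n) * (1 / D) < 1" using u D by (simp add: D_def field_simps)
      then have FD: "F (1 / D) = ennreal (u / D) * G + (\<Sum>j<Suc n. ennreal (1 / D) * K j)"
        unfolding F_def G_def K_def
        by (subst nn_integral_strips[where a = "Suc n" and x = "1 / D"])
          (use D in \<open>simp_all only: e, auto\<close>)
      have "ennreal (u / D) * ennreal (1 / D^2) = ennreal (u / D ^ 3)"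
        using u D by (simp add: ennreal_mult[symmetric] power3_eq_cube power2_eq_square)
      from swap[OF this] have G: "ennreal (u / D) * G * ennreal (1 / D^2) = H n u"
        unfolding H_def D_def[symmetric] G_def .
      have K: "ennreal (1 / D) * K j * ennreal (1 / D^2) = V j" for j
      proof -
        have "ennreal (1 / D) * ennreal (1 / D^2) = ennreal ((1 / D) ^ 3)"
          using D by (simp add: ennreal_mult[symmetric] power3_eq_cube power2_eq_square)
        from swap[OF this] have "ennreal (1 / D) * K j * ennreal (1 / D^2) = ennreal ((1 / D) ^ 3) * K j" .
        also have "\<dots> = (\<integral>\<^sup>+v. ennreal ((1 / D) ^ 3) * (f (1 / D, 1 - (real j + v) * (1 / D)) * indicator {0<..<1} v) \<partial>lborel)"
          unfolding K_def by (rule nn_integral_cmult[symmetric]) measurable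
        also have "\<dots> = V j"
          unfolding V_def branch_term_def inv_branch.simps denom.simps fst_conv D_def[symmetric]
          by (simp only: mult.assoc times_divide_eq_right mult_1_right)
        finally show ?thesis .
      qed
      have "F (1 / D) * ennreal (1 / D^2) = H n u + (\<Sum>j<Suc n. V j)"
        unfolding FD distrib_right sum_distrib_right G K ..
      then show ?thesis by (simp only: D_def V_def)
    qed
    have "(\<integral>\<^sup>+u. F (1 / (real (Suc n) + u)) * ennreal (1 / (real (Suc n) + u)^2) * indicator {0<..<1} u \<partial>lborel) =
        (\<integral>\<^sup>+u. H n u * indicator {0<..<1} u + (\<Sum>j<Suc n. (\<integral>\<^sup>+v. branch_term f (u, v) (Single (Suc n) j) *
          indicator {0<..<1} v \<partial>lborel) * indicator {0<..<1} u) \<partial>lborel)"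
      unfolding sum_distrib_right[symmetric] distrib_right[symmetric]
      by (intro nn_integral_cong) (auto split: split_indicator simp: pt simp del: sum.lessThan_Suc of_nat_Suc)
    also have "\<dots> = (\<integral>\<^sup>+u. H n u * indicator {0<..<1} u \<partial>lborel) + (\<Sum>j<Suc n. W (Single (Suc n) j))"
      unfolding W by (subst nn_integral_add, measurable, subst nn_integral_sum, measurable)
    finally show ?thesis .
  qed
  have double: "(\<integral>\<^sup>+u. H n (1 / (real (Suc m) + u)) * ennreal (1 / (real (Suc m) + u)^2) * indicator {0<..<1} u \<partial>lborel) =
      W (Double (Suc n) (Suc m))" for n m
    unfolding W
  proof (intro nn_integral_cong)
    fix u :: real
    show "H n (1 / (real (Suc m) + u)) * ennreal (1 / (real (Suc m) + u)^2) * indicator {0<..<1} u =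
      (\<integral>\<^sup>+v. branch_term f (u, v) (Double (Suc n) (Suc m)) * indicator {0<..<1} v \<partial>lborel) * indicator {0<..<1} u"
    proof (cases "u \<in> {0<..<1}")
      case True
      define w where "w = real (Suc m) + u"
      define a where "a = real (Suc n)"
      define D where "D = a * w + 1"
      have w: "w > 0" using True by (simp add: w_def)
      have D: "D > 0" using w by (simp add: D_def a_def add_pos_pos)
      have aw: "a + 1 / w = D / w" using w by (simp add: D_def field_simps)
      have "1 / w / (D / w) ^ 3 * (1 / w^2) = (1 / D) ^ 3"
        using w D by (simp add: field_simps power3_eq_cube power2_eq_square)
      then have c: "ennreal (1 / w / (D / w) ^ 3) * ennreal (1 / w^2) = ennreal ((1 / D) ^ 3)"
        using w D by (metis ennreal_mult less_imp_le divide_pos_pos zero_less_one zero_less_power)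
      have "H n (1 / w) * ennreal (1 / w^2) = ennreal (1 / w / (D / w) ^ 3) * ennreal (1 / w^2) *
          (\<integral>\<^sup>+v. f (1 / (D / w), v * (1 / w / (D / w))) * indicator {0<..<1} v \<partial>lborel)"
        unfolding H_def a_def[symmetric] aw by (rule swap[OF refl])
      also have "\<dots> = ennreal ((1 / D) ^ 3) * (\<integral>\<^sup>+v. f (w / D, v / D) * indicator {0<..<1} v \<partial>lborel)"
        unfolding c using w by simp
      also have "\<dots> = (\<integral>\<^sup>+v. ennreal ((1 / D) ^ 3) * (f (w / D, v / D) * indicator {0<..<1} v) \<partial>lborel)"
        by (rule nn_integral_cmult[symmetric]) measurable
      also have "\<dots> = (\<integral>\<^sup>+v. branch_term f (u, v) (Double (Suc n) (Suc m)) * indicator {0<..<1} v \<partial>lborel)"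
        by (simp only: branch_term_def inv_branch.simps denom.simps fst_conv D_def a_def w_def mult.assoc)
      finally show ?thesis by (simp add: w_def)
    qed simp
  qed
  have "(\<integral>\<^sup>+z. f z * indicator open_square z \<partial>lborel) = (\<integral>\<^sup>+x. F x * indicator {0<..<1} x \<partial>lborel)"
    unfolding F_def by (rule nn_integral_open_square[OF f])
  also have "\<dots> = (\<Sum>n. (\<integral>\<^sup>+u. H n u * indicator {0<..<1} u \<partial>lborel) + (\<Sum>j<Suc n. W (Single (Suc n) j)))"
    unfolding single[symmetric] by (rule nn_integral_gauss) measurable
  also have "\<dots> = (\<Sum>n. \<integral>\<^sup>+u. H n u * indicator {0<..<1} u \<partial>lborel) + (\<Sum>n. \<Sum>j<Suc n. W (Single (Suc n) j))"
    by (rule suminf_add[symmetric]) auto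
  also have "(\<Sum>n. \<integral>\<^sup>+u. H n u * indicator {0<..<1} u \<partial>lborel) =
      (\<integral>\<^sup>+u. (\<Sum>n. H n u) * indicator {0<..<1} u \<partial>lborel)"
    by (subst nn_integral_suminf[symmetric]) auto
  also have "\<dots> = (\<Sum>m. \<integral>\<^sup>+u. (\<Sum>n. H n (1 / (real (Suc m) + u))) * ennreal (1 / (real (Suc m) + u)^2) *
      indicator {0<..<1} u \<partial>lborel)"
    by (rule nn_integral_gauss) measurable
  also have "\<dots> = (\<Sum>m. \<Sum>n. W (Double (Suc n) (Suc m)))"
  proof (rule suminf_cong)
    fix m
    have "(\<integral>\<^sup>+u. (\<Sum>n. H n (1 / (real (Suc m) + u))) * ennreal (1 / (real (Suc m) + u)^2) *
        indicator {0<..<1} u \<partial>lborel) =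
      (\<integral>\<^sup>+u. (\<Sum>n. H n (1 / (real (Suc m) + u)) * ennreal (1 / (real (Suc m) + u)^2) *
        indicator {0<..<1} u) \<partial>lborel)" by (simp only: ennreal_suminf_multc)
    also have "\<dots> = (\<Sum>n. W (Double (Suc n) (Suc m)))"
      unfolding double[symmetric] by (rule nn_integral_suminf) measurable
    finally show "(\<integral>\<^sup>+u. (\<Sum>n. H n (1 / (real (Suc m) + u))) * ennreal (1 / (real (Suc m) + u)^2) *
        indicator {0<..<1} u \<partial>lborel) = (\<Sum>n. W (Double (Suc n) (Suc m)))" .
  qed
  also have "(\<Sum>m. \<Sum>n. W (Double (Suc n) (Suc m))) + (\<Sum>n. \<Sum>j<Suc n. W (Single (Suc n) j)) =
      (\<integral>\<^sup>+z. transfer f z * indicator open_square z \<partial>lborel)"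
  proof -
    have "(\<Sum>m. \<Sum>n. W (Double (Suc n) (Suc m))) =
        (\<integral>\<^sup>+z. (\<Sum>m. \<Sum>n. branch_term f z (Double (Suc n) (Suc m))) * indicator open_square z \<partial>lborel)"
      unfolding W_def ennreal_suminf_multc[symmetric]
      by (subst nn_integral_suminf, measurable, subst nn_integral_suminf, measurable)
    moreover have "(\<Sum>n. \<Sum>j<Suc n. W (Single (Suc n) j)) =
        (\<integral>\<^sup>+z. (\<Sum>n. \<Sum>j<Suc n. branch_term f z (Single (Suc n) j)) * indicator open_square z \<partial>lborel)"
      unfolding W_def ennreal_suminf_multc[symmetric] sum_distrib_right
      by (subst nn_integral_suminf, measurable, subst nn_integral_sum, measurable)
    ultimately show ?thesis
      unfolding transfer_def distrib_right by (subst nn_integral_add) (auto simp: add.commute)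
  qed
  finally show ?thesis by simp
qed

section \<open>The invariant density\<close>

text \<open>The slow map has the infinite invariant density \<open>1 / x\<close>. The jump map \<open>T_fast\<close> has as invariant
density the part of it that arrives from \<open>F_set\<close>. The complement of \<open>F_set\<close> is mapped by
\<open>(x, y) \<mapsto> (x / (1 - x), y / (1 - x))\<close>, whose inverse has Jacobian \<open>1 / (1 + u) ^ 3\<close>, so it contributes
\<open>((1 + u) / u) / (1 + u) ^ 3\<close>, and what remains is \<open>1 / u - 1 / (u * (1 + u)\<^sup>2)\<close>, which is the function
below.\<close>

definition inv_density :: "real \<times> real \<Rightarrow> real" where
  "inv_density z = 1 / (1 + fst z) + 1 / (1 + fst z)^2"

lemma inverse_shifted_tendsto_0:
  fixes c d :: real
  assumes "c > 0" "d > 0"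
  shows "(\<lambda>n. 1 / (real n * c + d)) \<longlonglongrightarrow> 0"
proof (rule real_tendsto_sandwich[OF _ _ tendsto_const])
  show "(\<lambda>n. (1 / c) * inverse (real n)) \<longlonglongrightarrow> 0"
    by (rule tendsto_mult_right_zero[OF lim_inverse_n])
  show "\<forall>\<^sub>F n in sequentially. 0 \<le> 1 / (real n * c + d)"
    using assms by auto
  show "\<forall>\<^sub>F n in sequentially. 1 / (real n * c + d) \<le> (1 / c) * inverse (real n)"
    using eventually_gt_at_top[of 0]
  proof eventually_elim
    case (elim n)
    have "1 / (real n * c + d) \<le> 1 / (real n * c)"
      using elim assms by (intro divide_left_mono mult_pos_pos add_pos_pos) auto
    then show ?case by (simp add: field_simps)
  qed
qed

text \<open>With \<open>w = n + 1 + u\<close> and \<open>S n = 1 / w\<^sup>2\<close>, the branches \<open>Single (n + 1) j\<close> contribute \<open>S n - S (n + 1)\<close>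
each, hence \<open>\<Sum>n. (n + 1) * (S n - S (n + 1)) = \<Sum>n. S n\<close> in total. The branches with second digit
\<open>b = n + 1\<close> telescope in \<open>a\<close> to \<open>1 / (w * (w + 1)\<^sup>2) = 1 / w - 1 / (w + 1) - S (n + 1)\<close>, hence in total
to \<open>1 / (1 + u) - \<Sum>n. S (n + 1)\<close>. The two tails cancel and leave \<open>1 / (1 + u) + S 0\<close>.\<close>

lemma transfer_inv_density:
  assumes "z \<in> open_square"
  shows "transfer (\<lambda>z. ennreal (inv_density z)) z = ennreal (inv_density z)"
proof -
  obtain u v where z: "z = (u, v)" by (cases z)
  have u: "0 < u" "u < 1" using assms z by auto
  define w where "w n = real (Suc n) + u" for n
  have w: "w n > 0" "w (Suc n) = w n + 1" for n using u by (auto simp: w_def)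
  define S where "S n = 1 / w n ^ 2" for n
  have single: "branch_term (\<lambda>z. ennreal (inv_density z)) z (Single (Suc n) j) = ennreal (S n - S (Suc n))" for n j
  proof -
    have "(1 / w n) ^ 3 * (1 / (1 + 1 / w n) + 1 / (1 + 1 / w n)^2) = S n - S (Suc n)"
      using w(1)[of n] unfolding S_def w(2)
      by (simp add: divide_simps) (simp add: algebra_simps power2_eq_square power3_eq_cube)
    then show ?thesis using w(1)[of n]
      by (simp add: z branch_term_def inv_density_def w_def[symmetric] ennreal_mult[symmetric] del: of_nat_Suc ennreal_plus)
  qed
  define t where "t n m = 1 / (real (Suc m) * w n + 1) ^ 2" for n m
  have double: "branch_term (\<lambda>z. ennreal (inv_density z)) z (Double (Suc m) (Suc n)) =
      ennreal (1 / w n * (t n m - t n (Suc m)))" for n m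
  proof -
    define D where "D = real (Suc m) * w n + 1"
    have D: "D > 0" using w(1)[of n] by (simp add: D_def add_pos_pos)
    have D': "real (Suc (Suc m)) * w n + 1 = D + w n" by (simp add: D_def algebra_simps)
    have "(1 / D) ^ 3 * (1 / (1 + w n / D) + 1 / (1 + w n / D)^2) = 1 / w n * (1 / D^2 - 1 / (D + w n)^2)"
    proof -
      have "1 + w n / D = (D + w n) / D" using D by (simp add: field_simps)
      moreover have "D + w n > 0" using D w(1)[of n] by simp
      ultimately show ?thesis
        using w(1)[of n] D by (simp add: divide_simps) (simp add: algebra_simps power2_eq_square power3_eq_cube)
    qed
    then have e: "(1 / D) ^ 3 * (1 / (1 + w n / D) + 1 / (1 + w n / D)^2) = 1 / w n * (t n m - t n (Suc m))"
      unfolding t_def D' D_def[symmetric] .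
    show ?thesis unfolding e[symmetric] using w(1)[of n] D
      by (simp add: z branch_term_def inv_density_def w_def[symmetric] D_def[symmetric] ennreal_mult[symmetric] del: of_nat_Suc ennreal_plus)
  qed
  have w_lim: "(\<lambda>n. 1 / w n) \<longlonglongrightarrow> 0"
    using inverse_shifted_tendsto_0[of 1 "1 + u"] u by (simp add: w_def ac_simps)
  have S_nonneg: "0 \<le> S n - S (Suc n)" for n
    using w(1)[of n] unfolding S_def w(2) by (simp add: frac_le power_mono)
  have t_nonneg: "0 \<le> 1 / w n * (t n m - t n (Suc m))" for n m
  proof -
    have "real (Suc m) * w n + 1 > 0" using w(1)[of n] by (simp add: add_pos_pos)
    moreover have "real (Suc m) * w n + 1 \<le> real (Suc (Suc m)) * w n + 1" using w(1)[of n] by (simp add: algebra_simps)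
    ultimately have "t n (Suc m) \<le> t n m" unfolding t_def by (intro divide_left_mono power_mono mult_pos_pos zero_less_power) auto
    then show ?thesis using w(1)[of n] by simp
  qed
  have t_sum: "(\<lambda>m. 1 / w n * (t n m - t n (Suc m))) sums (1 / w n - 1 / w (Suc n) - S (Suc n))" for n
  proof -
    have "(\<lambda>m. 1 / (real m * w n + (w n + 1))) \<longlonglongrightarrow> 0"
      using w(1)[of n] by (intro inverse_shifted_tendsto_0) auto
    then have "(\<lambda>m. (1 / (real m * w n + (w n + 1)))^2) \<longlonglongrightarrow> 0^2" by (rule tendsto_power)
    moreover have "t n = (\<lambda>m. (1 / (real m * w n + (w n + 1)))^2)"
      by (simp add: t_def fun_eq_iff power_one_over algebra_simps)
    ultimately have "t n \<longlonglongrightarrow> 0" by simp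
    from sums_mult[OF telescope_sums'[OF this], of "1 / w n"]
    have "(\<lambda>m. 1 / w n * (t n m - t n (Suc m))) sums (1 / w n * t n 0)" by simp
    also have "1 / w n * t n 0 = 1 / w n - 1 / w (Suc n) - S (Suc n)"
    proof -
      have "w n > 0" "w n + 1 > 0" using w(1)[of n] by auto
      then show ?thesis unfolding t_def S_def w(2)
        by (simp add: divide_simps) (simp add: algebra_simps power2_eq_square)
    qed
    finally show ?thesis .
  qed
  have "summable S"
  proof (rule summable_comparison_test')
    show "summable (\<lambda>n. inverse (real (Suc n) ^ 2))"
      using inverse_power_summable[of 2, where ?'a = real] summable_Suc_iff[of "\<lambda>n. inverse (real n ^ 2)"] by simp
    show "norm (S n) \<le> inverse (real (Suc n) ^ 2)" if "0 \<le> n" for n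
      using u by (auto simp: S_def w_def inverse_eq_divide intro!: divide_left_mono power_mono mult_pos_pos)
  qed
  then have S: "S sums suminf S" by (rule summable_sums)
  \<comment> \<open>Summation by parts: the boundary term of \<open>\<Sum>n. (n + 1) * (S n - S (n + 1))\<close> vanishes.\<close>
  have nS: "(\<lambda>n. real n * S n) \<longlonglongrightarrow> 0"
  proof (rule real_tendsto_sandwich[OF _ _ tendsto_const w_lim])
    show "\<forall>\<^sub>F n in sequentially. 0 \<le> real n * S n" by (simp add: S_def)
    have "real n * S n \<le> 1 / w n" for n
    proof -
      have "real n * S n \<le> w n * S n" using u by (intro mult_right_mono) (auto simp: w_def S_def)
      also have "\<dots> = 1 / w n" using w(1)[of n] by (simp add: S_def power2_eq_square)
      finally show ?thesis .
    qed
    then show "\<forall>\<^sub>F n in sequentially. real n * S n \<le> 1 / w n" by simp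
  qed
  have "(\<lambda>n. (real n * S n - real (Suc n) * S (Suc n)) + S n) sums (0 + suminf S)"
    using telescope_sums'[OF nS] by (intro sums_add S) simp
  then have A: "(\<lambda>n. real (Suc n) * (S n - S (Suc n))) sums suminf S"
    by (simp add: algebra_simps)
  have S1: "(\<lambda>n. S (Suc n)) sums (suminf S - S 0)" using S by (subst sums_Suc_iff) simp
  have B: "(\<lambda>n. 1 / w n - 1 / w (Suc n) - S (Suc n)) sums (1 / w 0 - (suminf S - S 0))"
    using telescope_sums'[OF w_lim] by (intro sums_diff S1) simp
  have B_nonneg: "0 \<le> 1 / w n - 1 / w (Suc n) - S (Suc n)" for n
    using sums_le[OF _ sums_zero t_sum[of n]] t_nonneg by blast
  have "transfer (\<lambda>z. ennreal (inv_density z)) z =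
      (\<Sum>n. \<Sum>j<Suc n. ennreal (S n - S (Suc n))) + (\<Sum>n. \<Sum>m. ennreal (1 / w n * (t n m - t n (Suc m))))"
    unfolding transfer_def single double ..
  also have "(\<lambda>n. \<Sum>j<Suc n. ennreal (S n - S (Suc n))) = (\<lambda>n. ennreal (real (Suc n) * (S n - S (Suc n))))"
    by (simp add: ennreal_mult' ennreal_of_nat_eq_real_of_nat S_nonneg fun_eq_iff del: of_nat_Suc sum.lessThan_Suc)
  also have "(\<Sum>n. ennreal (real (Suc n) * (S n - S (Suc n)))) = ennreal (suminf S)"
    using S_nonneg by (intro suminf_ennreal_eq A mult_nonneg_nonneg) auto
  also have "(\<lambda>n. \<Sum>m. ennreal (1 / w n * (t n m - t n (Suc m)))) = (\<lambda>n. ennreal (1 / w n - 1 / w (Suc n) - S (Suc n)))"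
    by (intro ext suminf_ennreal_eq t_sum t_nonneg)
  also have "(\<Sum>n. ennreal (1 / w n - 1 / w (Suc n) - S (Suc n))) = ennreal (1 / w 0 - (suminf S - S 0))"
    by (intro suminf_ennreal_eq B B_nonneg)
  also have "ennreal (suminf S) + ennreal (1 / w 0 - (suminf S - S 0)) = ennreal (suminf S + (1 / w 0 - (suminf S - S 0)))"
    using sums_le[OF _ sums_zero B] B_nonneg sums_le[OF _ sums_zero S] S_def
    by (intro ennreal_plus[symmetric]) auto
  also have "suminf S + (1 / w 0 - (suminf S - S 0)) = inv_density z"
    by (simp add: inv_density_def S_def w_def z)
  finally show ?thesis .
qed

section \<open>Contraction and distortion of the inverse branches\<close>

lemma denom_ge: 
  assumes "admissible i" "0 < u"
  shows "1 + u \<le> denom i u"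
proof (cases i)
  case (Double a b)
  then have "1 * (real b + u) \<le> real a * (real b + u)" "1 \<le> real b"
    using assms by (auto intro!: mult_right_mono)
  then show ?thesis using Double by simp
qed (use assms in auto)

text \<open>The denominator is affine in \<open>u\<close>, and for positive \<open>u\<close> its slope is at most its value.\<close>

lemma denom_ratio:
  assumes "admissible i" "0 < u" "0 < u'"
  shows "denom i u \<le> denom i u' * exp \<bar>u - u'\<bar>"
proof -
  have "denom i u \<le> denom i u' * (1 + \<bar>u - u'\<bar>)"
  proof (cases i)
    case (Single a j)
    then have "1 * \<bar>u - u'\<bar> \<le> (real a + u') * \<bar>u - u'\<bar>"
      using assms by (intro mult_right_mono) auto
    moreover have "u - u' \<le> \<bar>u - u'\<bar>" by simp
    ultimately show ?thesis using Single by (simp add: algebra_simps)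
  next
    case (Double a b)
    then have b: "1 \<le> real b" using assms by auto
    have "real a * 1 \<le> real a * (real b + u')" using b assms by (intro mult_left_mono) auto
    then have "real a * \<bar>u - u'\<bar> \<le> denom i u' * \<bar>u - u'\<bar>"
      using Double by (intro mult_right_mono) auto
    moreover have "real a * (u - u') \<le> real a * \<bar>u - u'\<bar>" by (intro mult_left_mono) auto
    ultimately show ?thesis using Double by (simp add: algebra_simps)
  qed
  also have "\<dots> \<le> denom i u' * exp \<bar>u - u'\<bar>"
    using denom_ge[OF assms(1,3)] assms exp_ge_add_one_self[of "\<bar>u - u'\<bar>"] by (intro mult_left_mono) auto
  finally show ?thesis .
qed

text \<open>Combined with \<open>1 + u \<le> denom k u\<close> this makes the product of two consecutive denominators at least 2,
although a single one can be arbitrarily close to 1.\<close>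

lemma fst_inv_branch_ge:
  assumes "admissible i" "z \<in> open_square"
  shows "1 / denom i (fst z) \<le> fst (inv_branch i z)"
proof (cases i)
  case (Double a b)
  have "denom i (fst z) > 0" using denom_ge[OF assms(1), of "fst z"] assms by auto
  then show ?thesis using Double assms by (cases z) (auto intro!: divide_right_mono)
qed (cases z, simp)

lemma fst_inv_branch_diff:
  assumes "admissible i" "z \<in> open_square" "z' \<in> open_square"
  shows "\<bar>fst (inv_branch i z) - fst (inv_branch i z')\<bar> =
    \<bar>fst z - fst z'\<bar> / (denom i (fst z) * denom i (fst z'))"
proof -
  obtain u v u' v' where z: "z = (u, v)" "z' = (u', v')" "0 < u" "0 < u'" using assms by auto
  have D: "denom i u > 0" "denom i u' > 0" using denom_ge[OF assms(1)] z by (smt (verit))+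
  have "\<bar>fst (inv_branch i z) - fst (inv_branch i z')\<bar> = \<bar>(u - u') / (denom i u * denom i u')\<bar>"
  proof (cases i)
    case (Single a j)
    have "1 / (real a + u) - 1 / (real a + u') = (u' - u) / ((real a + u) * (real a + u'))"
      using D Single by (simp add: field_simps)
    then show ?thesis using z Single by (simp add: abs_minus_commute)
  next
    case (Double a b)
    have "(real b + u) / denom i u - (real b + u') / denom i u' = (u - u') / (denom i u * denom i u')"
      using D by (simp add: diff_frac_eq) (simp add: Double algebra_simps)
    then show ?thesis using z Double by simp
  qed
  then show ?thesis using D z by simp
qed

text \<open>The inverse branch is affine in \<open>v\<close> with slope \<open>\<plusminus>1 / denom i u\<close>, and the effect of changing \<open>u\<close> is
at most as large.\<close>

lemma snd_inv_branch_diff: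
  assumes "admissible i" "z \<in> open_square" "z' \<in> open_square"
  shows "\<bar>snd (inv_branch i z) - snd (inv_branch i z')\<bar> \<le>
    (\<bar>fst z - fst z'\<bar> + \<bar>snd z - snd z'\<bar>) / denom i (fst z)"
proof -
  obtain u v u' v' where z: "z = (u, v)" "z' = (u', v')" "0 < u" "0 < u'" "0 < v'" "v' < 1" using assms by auto
  define D where "D = denom i u"
  define D' where "D' = denom i u'"
  have D: "D > 0" "D' > 0" using denom_ge[OF assms(1)] z unfolding D_def D'_def by (smt (verit))+
  \<comment> \<open>The coefficient \<open>c\<close> measures the shear of the branch; its bound uses \<open>j + 1 \<le> a\<close> or \<open>1 \<le> b\<close>.\<close>
  have "\<exists>c. \<bar>c\<bar> \<le> 1 \<and> \<bar>snd (inv_branch i z) - snd (inv_branch i z')\<bar> = \<bar>(c * (u - u') + (v - v')) / D\<bar>"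
  proof (cases i)
    case (Single a j)
    define c where "c = - (real j + v') / D'"
    have "real j + 1 \<le> real a" using Single assms by (simp flip: of_nat_Suc)
    then have "real j + v' \<le> D'" using z Single by (simp add: D'_def)
    then have "\<bar>c\<bar> \<le> 1" using z D by (simp add: c_def)
    moreover have "(real j + v') / D' - (real j + v) / D = - (c * (u - u') + (v - v')) / D"
      using D by (simp add: diff_frac_eq c_def divide_simps) (simp add: D_def D'_def Single algebra_simps)
    ultimately show ?thesis using z Single by (intro exI[of _ c]) (simp add: D_def D'_def)
  next
    case (Double a b)
    define c where "c = - real a * v' / D'"
    have "real a * v' \<le> real a * 1" using z by (intro mult_left_mono) auto
    also have "\<dots> \<le> real a * (real b + u')" using Double assms z by (intro mult_left_mono) auto
    also have "\<dots> \<le> D'" by (simp add: D'_def Double)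
    finally have "\<bar>c\<bar> \<le> 1" using z D by (simp add: c_def)
    moreover have "v / D - v' / D' = (c * (u - u') + (v - v')) / D"
      using D by (simp add: diff_frac_eq c_def divide_simps) (simp add: D_def D'_def Double algebra_simps)
    ultimately show ?thesis using z Double by (intro exI[of _ c]) (simp add: D_def D'_def)
  qed
  then obtain c where c: "\<bar>c\<bar> \<le> 1"
    "\<bar>snd (inv_branch i z) - snd (inv_branch i z')\<bar> = \<bar>(c * (u - u') + (v - v')) / D\<bar>" by blast
  have "\<bar>c * (u - u') + (v - v')\<bar> \<le> \<bar>c\<bar> * \<bar>u - u'\<bar> + \<bar>v - v'\<bar>"
    using abs_triangle_ineq[of "c * (u - u')" "v - v'"] by (simp add: abs_mult)
  also have "\<dots> \<le> 1 * \<bar>u - u'\<bar> + \<bar>v - v'\<bar>" using c by (intro add_right_mono mult_right_mono) auto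
  finally show ?thesis using c D z by (simp add: D_def divide_right_mono)
qed

text \<open>Two steps change the horizontal distance \<open>X\<close> and the vertical distance \<open>Y\<close> to at most \<open>X / 4\<close> and
\<open>X + Y / 2\<close>. The weight 4 is what turns this into a contraction by the factor 2 of one quantity.\<close>

definition wdist :: "real \<times> real \<Rightarrow> real \<times> real \<Rightarrow> real" where
  "wdist z z' = 4 * \<bar>fst z - fst z'\<bar> + \<bar>snd z - snd z'\<bar>"

text \<open>One step does not contract uniformly: \<open>Single 1 0\<close> has denominator \<open>1 + u\<close>, with \<open>u\<close> possibly near 0.
Two consecutive denominators have a product of at least 2.\<close>

lemma two_step_contraction:
  assumes "admissible i" "admissible k" "z \<in> open_square" "z' \<in> open_square"
  shows "\<bar>fst (inv_branch k (inv_branch i z)) - fst (inv_branch k (inv_branch i z'))\<bar> \<le> \<bar>fst z - fst z'\<bar> / 4"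
    and "wdist (inv_branch k (inv_branch i z)) (inv_branch k (inv_branch i z')) \<le> wdist z z' / 2"
proof -
  define p p' where "p = inv_branch i z" and "p' = inv_branch i z'"
  have pQ: "p \<in> open_square" "p' \<in> open_square"
    using assms by (auto simp: p_def p'_def intro!: inv_branch_in_open_square simp del: mem_Times_iff)
  define q q' where "q = inv_branch k p" and "q' = inv_branch k p'"
  define X Y where "X = \<bar>fst z - fst z'\<bar>" and "Y = \<bar>snd z - snd z'\<bar>"
  define D D' E E' where "D = denom i (fst z)" and "D' = denom i (fst z')"
    and "E = denom k (fst p)" and "E' = denom k (fst p')"
  have D1: "1 \<le> D" "1 \<le> D'" using denom_ge[OF assms(1)] assms unfolding D_def D'_def by (force simp: mem_Times_iff)+
  have E1: "1 + 1 / D \<le> E" "1 + 1 / D' \<le> E'"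
    using denom_ge[OF assms(2), of "fst p"] denom_ge[OF assms(2), of "fst p'"] pQ
      fst_inv_branch_ge[OF assms(1,3)] fst_inv_branch_ge[OF assms(1,4)]
    unfolding D_def D'_def E_def E'_def p_def p'_def by (auto simp: mem_Times_iff)
  have DE: "2 \<le> D * E" if "1 \<le> D" "1 + 1 / D \<le> E" for D E :: real
  proof -
    have "D * (1 + 1 / D) \<le> D * E" using that by (intro mult_left_mono) auto
    then show ?thesis using that by (simp add: algebra_simps)
  qed
  have two: "2 \<le> D * E" "2 \<le> D' * E'" using DE D1 E1 by auto
  have Epos: "E > 0" "E' > 0" using E1 D1 by (smt (verit) divide_nonneg_nonneg)+
  have px: "\<bar>fst p - fst p'\<bar> = X / (D * D')"
    unfolding p_def p'_def X_def D_def D'_def by (rule fst_inv_branch_diff) (use assms in auto)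
  have py: "\<bar>snd p - snd p'\<bar> \<le> (X + Y) / D"
    unfolding p_def p'_def X_def Y_def D_def by (rule snd_inv_branch_diff) (use assms in auto)
  have qx: "\<bar>fst q - fst q'\<bar> = \<bar>fst p - fst p'\<bar> / (E * E')"
    unfolding q_def q'_def E_def E'_def by (rule fst_inv_branch_diff[OF assms(2) pQ])
  have qy: "\<bar>snd q - snd q'\<bar> \<le> (\<bar>fst p - fst p'\<bar> + \<bar>snd p - snd p'\<bar>) / E"
    unfolding q_def q'_def E_def by (rule snd_inv_branch_diff[OF assms(2) pQ])
  have XY: "0 \<le> X" "0 \<le> Y" by (auto simp: X_def Y_def)
  have "2 * 2 \<le> (D * E) * (D' * E')" using two by (intro mult_mono) auto
  moreover have "\<bar>fst q - fst q'\<bar> = X / ((D * E) * (D' * E'))" unfolding qx px by (simp add: ac_simps)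
  ultimately have x4: "\<bar>fst q - fst q'\<bar> \<le> X / 4"
    using divide_left_mono[of "2 * 2" "(D * E) * (D' * E')" X] XY by simp
  then show "\<bar>fst (inv_branch k (inv_branch i z)) - fst (inv_branch k (inv_branch i z'))\<bar> \<le> \<bar>fst z - fst z'\<bar> / 4"
    by (simp add: q_def q'_def p_def p'_def X_def)
  have "X / (D * D') \<le> X / (D * 1)" using D1 XY by (intro divide_left_mono mult_left_mono mult_pos_pos) auto
  then have "\<bar>fst p - fst p'\<bar> + \<bar>snd p - snd p'\<bar> \<le> (2 * X + Y) / D"
    using px py by (simp add: add_divide_distrib)
  then have "\<bar>snd q - snd q'\<bar> \<le> (2 * X + Y) / D / E"
    using qy Epos by (meson divide_right_mono less_imp_le order_trans)
  also have "\<dots> = (2 * X + Y) / (D * E)" by simp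
  also have "\<dots> \<le> (2 * X + Y) / 2" using two XY by (intro divide_left_mono) auto
  finally have "\<bar>snd q - snd q'\<bar> \<le> (2 * X + Y) / 2" .
  then have "wdist q q' \<le> (4 * X + Y) / 2" using x4 by (simp add: wdist_def)
  then show "wdist (inv_branch k (inv_branch i z)) (inv_branch k (inv_branch i z')) \<le> wdist z z' / 2"
    by (simp add: q_def q'_def p_def p'_def X_def Y_def wdist_def)
qed

lemma transfer_mono_scaled:
  assumes "\<And>i. admissible i \<Longrightarrow> c * branch_term g z' i \<le> branch_term f z i"
  shows "c * transfer g z' \<le> transfer f z"
  unfolding transfer_def distrib_left ennreal_suminf_cmult[symmetric] sum_distrib_left
  by (intro add_mono suminf_le sum_mono assms summableI) auto

section \<open>Bounded distortion as a property of the transfer operator\<close>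

text \<open>A relation that survives two applications of the transfer operator while the scale \<open>\<delta>\<close> doubles.
After enough iterations \<open>\<delta>\<close> exceeds the size of the square, and the comparison of \<open>f\<close> and \<open>g\<close> at nearby points has
become a comparison at arbitrary points. The constant 8 solves the bookkeeping for two steps: each
Jacobian costs \<open>3 * X\<close> in the exponent, and the old exponent \<open>8 * X\<close> is divided by 4, so that
\<open>3 + 3 + 8 / 4 = 8\<close>.\<close>

definition dominates :: "real \<Rightarrow> (real \<times> real \<Rightarrow> ennreal) \<Rightarrow> (real \<times> real \<Rightarrow> ennreal) \<Rightarrow> bool" where
  "dominates \<delta> f g \<longleftrightarrow> (\<forall>z\<in>open_square. \<forall>z'\<in>open_square. wdist z z' \<le> \<delta> \<longrightarrow>
     ennreal (exp (- 8 * \<bar>fst z - fst z'\<bar>)) * g z' \<le> f z)"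

lemma jacobian_ratio:
  assumes "admissible i" "0 < u" "0 < u'"
  shows "ennreal (exp (- 3 * \<bar>u - u'\<bar>)) * ennreal ((1 / denom i u') ^ 3) \<le> ennreal ((1 / denom i u) ^ 3)"
proof -
  have D: "denom i u > 0" "denom i u' > 0" using denom_ge[OF assms(1)] assms by (smt (verit))+
  have "exp (- \<bar>u - u'\<bar>) * (1 / denom i u') \<le> 1 / denom i u"
    using denom_ratio[OF assms] D by (simp add: exp_minus field_simps)
  then have "(exp (- \<bar>u - u'\<bar>) * (1 / denom i u')) ^ 3 \<le> (1 / denom i u) ^ 3"
    using D by (intro power_mono) auto
  then have "exp (- \<bar>u - u'\<bar>) ^ 3 * (1 / denom i u') ^ 3 \<le> (1 / denom i u) ^ 3"
    by (simp only: power_mult_distrib)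
  moreover have "exp (- \<bar>u - u'\<bar>) ^ 3 = exp (- 3 * \<bar>u - u'\<bar>)"
    by (simp flip: exp_of_nat_mult)
  ultimately have "exp (- 3 * \<bar>u - u'\<bar>) * (1 / denom i u') ^ 3 \<le> (1 / denom i u) ^ 3" by simp
  then show ?thesis using D by (subst ennreal_mult[symmetric]) (auto intro: ennreal_leI)
qed

lemma dominates_transfer_twice:
  assumes dom: "dominates \<delta> f g"
  shows "dominates (2 * \<delta>) (transfer (transfer f)) (transfer (transfer g))"
  unfolding dominates_def
proof (intro ballI impI)
  fix z z' assume Q: "z \<in> open_square" "z' \<in> open_square" and w: "wdist z z' \<le> 2 * \<delta>"
  define X where "X = \<bar>fst z - fst z'\<bar>"
  have X: "0 \<le> X" by (simp add: X_def)
  have pos: "0 < fst z" "0 < fst z'" using Q by auto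
  have split: "ennreal (exp (- 3 * X)) * ennreal (exp (- 5 * X)) = ennreal (exp (- 8 * X))"
    by (simp add: ennreal_mult[symmetric] exp_add[symmetric])
  show "ennreal (exp (- 8 * X)) * transfer (transfer g) z' \<le> transfer (transfer f) z"
  proof (rule transfer_mono_scaled)
    fix i assume i: "admissible i"
    define p p' where "p = inv_branch i z" and "p' = inv_branch i z'"
    have pQ: "p \<in> open_square" "p' \<in> open_square"
      unfolding p_def p'_def using i Q by (auto intro: inv_branch_in_open_square simp del: mem_Times_iff)
    have ppos: "0 < fst p" "0 < fst p'" using pQ by auto
    have D1: "1 \<le> denom i (fst z)" "1 \<le> denom i (fst z')" using denom_ge[OF i] pos by (smt (verit))+
    have pX: "\<bar>fst p - fst p'\<bar> \<le> X"
    proof -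
      have "X / (denom i (fst z) * denom i (fst z')) \<le> X / (1 * 1)"
        using D1 X by (intro divide_left_mono mult_mono) auto
      then show ?thesis using fst_inv_branch_diff[OF i Q] by (simp add: p_def p'_def X_def)
    qed
    have "ennreal (exp (- 5 * X)) * transfer g p' \<le> transfer f p"
    proof (rule transfer_mono_scaled)
      fix k assume k: "admissible k"
      define q q' where "q = inv_branch k p" and "q' = inv_branch k p'"
      have qQ: "q \<in> open_square" "q' \<in> open_square"
        unfolding q_def q'_def using k pQ by (auto intro: inv_branch_in_open_square simp del: mem_Times_iff)
      have qX: "\<bar>fst q - fst q'\<bar> \<le> X / 4" and "wdist q q' \<le> \<delta>"
        using two_step_contraction[OF i k Q] w by (auto simp: q_def q'_def p_def p'_def X_def)
      then have fg: "ennreal (exp (- 8 * \<bar>fst q - fst q'\<bar>)) * g q' \<le> f q"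
        using dom qQ unfolding dominates_def by blast
      \<comment> \<open>The inner step accounts for \<open>3 + 8 / 4 = 5\<close>, the outer Jacobian for the remaining 3.\<close>
      have "exp (- 5 * X) \<le> exp (- 3 * \<bar>fst p - fst p'\<bar>) * exp (- 8 * \<bar>fst q - fst q'\<bar>)"
        unfolding exp_add[symmetric] using pX qX by simp
      then have "ennreal (exp (- 5 * X)) \<le> ennreal (exp (- 3 * \<bar>fst p - fst p'\<bar>)) * ennreal (exp (- 8 * \<bar>fst q - fst q'\<bar>))"
        by (simp add: ennreal_mult[symmetric] ennreal_leI)
      then have "ennreal (exp (- 5 * X)) * branch_term g p' k \<le>
          ennreal (exp (- 3 * \<bar>fst p - fst p'\<bar>)) * ennreal (exp (- 8 * \<bar>fst q - fst q'\<bar>)) * branch_term g p' k"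
        by (rule mult_right_mono) simp
      also have "\<dots> = (ennreal (exp (- 3 * \<bar>fst p - fst p'\<bar>)) * ennreal ((1 / denom k (fst p')) ^ 3)) *
          (ennreal (exp (- 8 * \<bar>fst q - fst q'\<bar>)) * g q')"
        by (simp only: branch_term_def q'_def ac_simps)
      also have "\<dots> \<le> ennreal ((1 / denom k (fst p)) ^ 3) * f q"
        by (intro mult_mono jacobian_ratio k ppos fg) auto
      finally show "ennreal (exp (- 5 * X)) * branch_term g p' k \<le> branch_term f p k"
        by (simp only: branch_term_def q_def)
    qed
    then have "(ennreal (exp (- 3 * X)) * ennreal ((1 / denom i (fst z')) ^ 3)) * (ennreal (exp (- 5 * X)) * transfer g p')
        \<le> ennreal ((1 / denom i (fst z)) ^ 3) * transfer f p"
      unfolding X_def by (intro mult_mono jacobian_ratio i pos) auto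
    then show "ennreal (exp (- 8 * X)) * branch_term (transfer g) z' i \<le> branch_term (transfer f) z i"
      unfolding branch_term_def split[symmetric] p_def p'_def by (simp only: ac_simps)
  qed
qed

section \<open>Integration over the square\<close>

lemma emeasure_square:
  "emeasure lborel unit_square = 1" "emeasure lborel open_square = 1"
proof -
  have "emeasure lborel (A \<times> B) = emeasure lborel A * emeasure lborel B"
    if "A \<in> sets borel" "B \<in> sets borel" for A B :: "real set"
    unfolding lborel_prod[symmetric] using that by (intro lborel.emeasure_pair_measure_Times) auto
  then show "emeasure lborel unit_square = 1" "emeasure lborel open_square = 1"
    by (simp_all add: unit_square_def)
qed

lemma AE_unit_square_iff_open_square: "AE z in lborel. z \<in> unit_square \<longleftrightarrow> z \<in> open_square"
proof -
  have sub: "open_square \<subseteq> unit_square" by (auto simp: unit_square_def)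
  have "emeasure lborel (unit_square - open_square) = 0"
    using sub by (subst emeasure_Diff) (auto simp: emeasure_square)
  then have "unit_square - open_square \<in> null_sets lborel" by auto
  from AE_not_in[OF this] show ?thesis by eventually_elim (use sub in auto)
qed

lemma nn_integral_lebesgue_square:
  "(\<integral>\<^sup>+z. f z \<partial>lebesgue_square) = (\<integral>\<^sup>+z. f z * indicator open_square z \<partial>lborel)"
proof -
  have "(\<integral>\<^sup>+z. f z \<partial>lebesgue_square) = (\<integral>\<^sup>+z. f z * indicator unit_square z \<partial>lborel)"
    unfolding lebesgue_square_def by (rule nn_integral_restrict_space) simp
  also have "\<dots> = (\<integral>\<^sup>+z. f z * indicator open_square z \<partial>lborel)"
    using AE_unit_square_iff_open_square
    by (intro nn_integral_cong_AE) (auto elim!: eventually_mono split: split_indicator)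
  finally show ?thesis .
qed

lemma space_lebesgue_square: "space lebesgue_square = unit_square"
  by (simp add: lebesgue_square_def space_restrict_space)

lemma sets_lebesgue_square: "A \<in> sets lebesgue_square \<longleftrightarrow> A \<in> sets borel \<and> A \<subseteq> unit_square"
  unfolding lebesgue_square_def by (subst sets_restrict_space_iff) auto

lemma measurable_lebesgue_square:
  "f \<in> measurable borel N \<Longrightarrow> f \<in> measurable lebesgue_square N"
  unfolding lebesgue_square_def by (intro measurable_restrict_space1) simp

section \<open>Duality and invariant sets\<close>

lemma transfer_factor:
  assumes "\<And>i. admissible i \<Longrightarrow> g (inv_branch i z) = c"
  shows "transfer (\<lambda>z. g z * f z) z = c * transfer f z"
proof -
  have "branch_term (\<lambda>z. g z * f z) z i = c * branch_term f z i" if "admissible i" for i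
    using assms[OF that] by (simp add: branch_term_def ac_simps)
  then show ?thesis
    unfolding transfer_def distrib_left ennreal_suminf_cmult[symmetric] sum_distrib_left
    by (intro arg_cong2[where f = plus] suminf_cong sum.cong) auto
qed

text \<open>Since \<open>T_fast\<close> undoes every inverse branch, a factor \<open>g \<circ> T_fast\<close> leaves the transfer operator as \<open>g\<close>.\<close>

lemma nn_integral_koopman:
  assumes [measurable]: "f \<in> borel_measurable borel" "g \<in> borel_measurable borel"
  shows "(\<integral>\<^sup>+z. (g (T_fast z) * f z) * indicator open_square z \<partial>lborel) =
    (\<integral>\<^sup>+z. (g z * transfer f z) * indicator open_square z \<partial>lborel)"
proof -
  have "(\<integral>\<^sup>+z. (g (T_fast z) * f z) * indicator open_square z \<partial>lborel) =
      (\<integral>\<^sup>+z. transfer (\<lambda>z. g (T_fast z) * f z) z * indicator open_square z \<partial>lborel)"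
    by (rule nn_integral_transfer[symmetric]) measurable
  also have "\<dots> = (\<integral>\<^sup>+z. (g z * transfer f z) * indicator open_square z \<partial>lborel)"
  proof (intro nn_integral_cong)
    fix z :: "real \<times> real"
    show "transfer (\<lambda>z. g (T_fast z) * f z) z * indicator open_square z =
        (g z * transfer f z) * indicator open_square z"
    proof (cases "z \<in> open_square")
      case True
      have "transfer (\<lambda>z. g (T_fast z) * f z) z = g z * transfer f z"
        by (rule transfer_factor) (simp only: T_fast_inv_branch[OF _ True])
      then show ?thesis by simp
    next
      case False
      then have "indicator open_square z = (0 :: ennreal)" by (rule indicator_simps(2))
      then show ?thesis by (simp only: mult_zero_right)
    qed
  qed
  finally show ?thesis .
qed

text \<open>Iterates are taken two steps at a time, since only two steps contract.\<close>

abbreviation transfer2 :: "(real \<times> real \<Rightarrow> ennreal) \<Rightarrow> real \<times> real \<Rightarrow> ennreal" where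
  "transfer2 f \<equiv> transfer (transfer f)"

lemma transfer2_power_measurable [measurable]:
  assumes "f \<in> borel_measurable borel"
  shows "(transfer2 ^^ n) f \<in> borel_measurable borel"
  using assms by (induction n) (auto intro: transfer_measurable)

lemma dominates_transfer2_power:
  "dominates \<delta> f g \<Longrightarrow> dominates (2 ^ n * \<delta>) ((transfer2 ^^ n) f) ((transfer2 ^^ n) g)"
proof (induction n)
  case (Suc n)
  from dominates_transfer_twice[OF Suc.IH[OF Suc.prems]] show ?case by (simp add: ac_simps)
qed simp

lemma nn_integral_invariant_set:
  assumes A: "A \<in> sets borel" "T_fast -` A \<inter> unit_square = A" and f: "f \<in> borel_measurable borel"
  shows "(\<integral>\<^sup>+z. (indicator A z * transfer f z) * indicator open_square z \<partial>lborel) =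
    (\<integral>\<^sup>+z. (indicator A z * f z) * indicator open_square z \<partial>lborel)"
proof -
  have sub: "z \<in> open_square \<Longrightarrow> z \<in> unit_square" for z by (auto simp: unit_square_def)
  have "(\<integral>\<^sup>+z. (indicator A z * transfer f z) * indicator open_square z \<partial>lborel) =
    (\<integral>\<^sup>+z. (indicator A (T_fast z) * f z) * indicator open_square z \<partial>lborel)"
    by (rule nn_integral_koopman[symmetric]) (use A f in auto)
  also have "\<dots> = (\<integral>\<^sup>+z. (indicator A z * f z) * indicator open_square z \<partial>lborel)"
    by (intro nn_integral_cong) (use A sub in \<open>auto split: split_indicator\<close>)
  finally show ?thesis .
qed

lemma nn_integral_invariant_set_power:
  assumes A: "A \<in> sets borel" "T_fast -` A \<inter> unit_square = A" and f: "f \<in> borel_measurable borel"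
  shows "(\<integral>\<^sup>+z. (indicator A z * (transfer2 ^^ n) f z) * indicator open_square z \<partial>lborel) =
    (\<integral>\<^sup>+z. (indicator A z * f z) * indicator open_square z \<partial>lborel)"
proof (induction n)
  case (Suc n)
  have m: "(transfer2 ^^ n) f \<in> borel_measurable borel" using f by (rule transfer2_power_measurable)
  show ?case
    using nn_integral_invariant_set[OF A transfer_measurable[OF m]] nn_integral_invariant_set[OF A m] Suc
    by simp
qed simp

lemma nn_integral_transfer2_power:
  assumes f: "f \<in> borel_measurable borel"
  shows "(\<integral>\<^sup>+z. (transfer2 ^^ n) f z * indicator open_square z \<partial>lborel) =
    (\<integral>\<^sup>+z. f z * indicator open_square z \<partial>lborel)"
proof (induction n)
  case (Suc n)
  have m: "(transfer2 ^^ n) f \<in> borel_measurable borel" using f by (rule transfer2_power_measurable)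
  show ?case using nn_integral_transfer[OF transfer_measurable[OF m]] nn_integral_transfer[OF m] Suc by simp
qed simp

section \<open>Ergodicity\<close>

text \<open>The indicator of \<open>U\<close> dominates that of \<open>K\<close> at the scale given by the distance of \<open>K\<close> from the
complement of \<open>U\<close>. Applying the transfer operator often enough, the images \<open>F\<close> and \<open>G\<close> satisfy
\<open>exp (- 8) * G z' \<le> F z\<close> for all \<open>z\<close> and \<open>z'\<close>. Integrating over \<open>z \<in> A\<close> and over all \<open>z'\<close> gives the claim:
the transfer operator preserves integrals over the square, and over \<open>A\<close> as well because \<open>A\<close> is
invariant.\<close>

lemma invariant_mixing_bound:
  assumes A: "A \<in> sets borel" "T_fast -` A \<inter> unit_square = A"
    and K: "compact K" and U: "open U" "K \<subseteq> U"
  shows "ennreal (exp (- 8)) * emeasure lborel (A \<inter> open_square) * emeasure lborel (K \<inter> open_square)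
    \<le> emeasure lborel (A \<inter> U \<inter> open_square)"
proof -
  obtain e where e: "e > 0" "(\<Union>x\<in>K. ball x e) \<subseteq> U"
    using compact_subset_open_imp_ball_epsilon_subset[OF K U] .
  have [measurable]: "A \<in> sets borel" "K \<in> sets borel" "U \<in> sets borel"
    using A K U by (auto intro: borel_compact)
  let ?f = "indicator U :: real \<times> real \<Rightarrow> ennreal" and ?g = "indicator K :: real \<times> real \<Rightarrow> ennreal"
  have dist: "dist z' z \<le> wdist z z'" for z z' :: "real \<times> real"
  proof -
    have "dist z' z \<le> \<bar>fst z - fst z'\<bar> + \<bar>snd z - snd z'\<bar>"
      unfolding dist_prod_def dist_real_def using sqrt_sum_squares_le_sum_abs[of "fst z' - fst z" "snd z' - snd z"]
      by (simp add: abs_minus_commute)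
    also have "\<dots> \<le> wdist z z'" unfolding wdist_def by (intro add_right_mono) simp
    finally show ?thesis .
  qed
  have "dominates (e / 2) ?f ?g"
    unfolding dominates_def
  proof (intro ballI impI)
    fix z z' assume w: "wdist z z' \<le> e / 2"
    have "z \<in> U" if "z' \<in> K"
      using dist[of z' z] w e that by (force simp: mem_ball)
    then show "ennreal (exp (- 8 * \<bar>fst z - fst z'\<bar>)) * ?g z' \<le> ?f z"
      by (auto split: split_indicator)
  qed
  \<comment> \<open>In the metric \<open>wdist\<close> the open square has diameter 5.\<close>
  obtain n where n: "10 / e < 2 ^ n" using real_arch_pow[of 2 "10 / e"] by auto
  then have n5: "5 \<le> 2 ^ n * (e / 2)" using e by (simp add: field_simps)
  define F G where "F = (transfer2 ^^ n) ?f" and "G = (transfer2 ^^ n) ?g"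
  have [measurable]: "F \<in> borel_measurable borel" "G \<in> borel_measurable borel"
    unfolding F_def G_def by (intro transfer2_power_measurable; simp)+
  have FG: "ennreal (exp (- 8)) * G z' \<le> F z" if Q: "z \<in> open_square" "z' \<in> open_square" for z z'
  proof -
    have lt: "\<bar>fst z - fst z'\<bar> \<le> 1" "\<bar>snd z - snd z'\<bar> \<le> 1" using Q by (auto simp: mem_Times_iff)
    then have "wdist z z' \<le> 2 ^ n * (e / 2)" using n5 by (simp add: wdist_def)
    then have "ennreal (exp (- 8 * \<bar>fst z - fst z'\<bar>)) * G z' \<le> F z"
      using dominates_transfer2_power[OF \<open>dominates (e / 2) ?f ?g\<close>, of n] Q
      unfolding dominates_def F_def G_def by blast
    moreover have "ennreal (exp (- 8)) * G z' \<le> ennreal (exp (- 8 * \<bar>fst z - fst z'\<bar>)) * G z'"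
      using lt by (intro mult_right_mono ennreal_leI) auto
    ultimately show ?thesis by (rule order_trans[rotated])
  qed
  let ?I = "\<lambda>z. indicator open_square z :: ennreal"
  define \<alpha> where "\<alpha> = emeasure lborel (A \<inter> open_square)"
  have step: "ennreal (exp (- 8)) * \<alpha> * G z' \<le> emeasure lborel (A \<inter> U \<inter> open_square)"
    if Q: "z' \<in> open_square" for z'
  proof -
    have "ennreal (exp (- 8)) * G z' * \<alpha> = (\<integral>\<^sup>+z. ennreal (exp (- 8)) * G z' * indicator (A \<inter> open_square) z \<partial>lborel)"
      unfolding \<alpha>_def by (rule nn_integral_cmult_indicator[symmetric]) simp
    also have "\<dots> \<le> (\<integral>\<^sup>+z. (indicator A z * F z) * ?I z \<partial>lborel)"
      by (intro nn_integral_mono) (use FG[OF _ Q] in \<open>auto split: split_indicator\<close>)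
    also have "\<dots> = (\<integral>\<^sup>+z. (indicator A z * ?f z) * ?I z \<partial>lborel)"
      unfolding F_def by (rule nn_integral_invariant_set_power[OF A]) simp
    also have "\<dots> = (\<integral>\<^sup>+z. indicator (A \<inter> U \<inter> open_square) z \<partial>lborel)"
      by (intro nn_integral_cong) (auto split: split_indicator)
    also have "\<dots> = emeasure lborel (A \<inter> U \<inter> open_square)" by simp
    finally show ?thesis by (simp add: ac_simps)
  qed
  have "ennreal (exp (- 8)) * \<alpha> * emeasure lborel (K \<inter> open_square) =
      ennreal (exp (- 8)) * \<alpha> * (\<integral>\<^sup>+z. ?g z * ?I z \<partial>lborel)"
    by (simp add: indicator_inter_arith[symmetric])
  also have "(\<integral>\<^sup>+z. ?g z * ?I z \<partial>lborel) = (\<integral>\<^sup>+z. G z * ?I z \<partial>lborel)"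
    unfolding G_def by (rule nn_integral_transfer2_power[symmetric]) simp
  also have "ennreal (exp (- 8)) * \<alpha> * (\<integral>\<^sup>+z. G z * ?I z \<partial>lborel) =
      (\<integral>\<^sup>+z. ennreal (exp (- 8)) * \<alpha> * (G z * ?I z) \<partial>lborel)"
    by (rule nn_integral_cmult[symmetric]) simp
  also have "\<dots> \<le> (\<integral>\<^sup>+z. emeasure lborel (A \<inter> U \<inter> open_square) * ?I z \<partial>lborel)"
    by (intro nn_integral_mono) (use step in \<open>auto split: split_indicator\<close>)
  also have "\<dots> = emeasure lborel (A \<inter> U \<inter> open_square)"
    by (subst nn_integral_cmult_indicator) (auto simp: emeasure_square)
  finally show ?thesis unfolding \<alpha>_def .
qed

text \<open>If \<open>A\<close> and its complement \<open>B\<close> both had positive measure, one could take a compact \<open>K \<subseteq> B\<close> with at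
least half of the measure of \<open>B\<close> and an open \<open>U \<supseteq> B\<close> that meets \<open>A\<close> in arbitrarily small measure. This
contradicts the bound above, whose left-hand side does not depend on \<open>U\<close>.\<close>

lemma invariant_set_trivial:
  assumes A: "A \<in> sets borel" "T_fast -` A \<inter> unit_square = A"
  shows "emeasure lborel A = 0 \<or> emeasure lborel (unit_square - A) = 0"
proof (rule ccontr)
  assume nz: "\<not> ?thesis"
  define B where "B = unit_square - A"
  have Asub: "A \<subseteq> unit_square" using A(2) by auto
  have [measurable]: "A \<in> sets borel" "B \<in> sets borel" using A by (auto simp: B_def)
  have le1: "emeasure lborel C \<le> 1" if "C \<subseteq> unit_square" for C
    using emeasure_mono[OF that, of lborel] by (simp add: emeasure_square)
  have Q: "emeasure lborel (C \<inter> open_square) = emeasure lborel C" if "C \<subseteq> unit_square" "C \<in> sets borel" for C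
    using AE_unit_square_iff_open_square that
    by (intro emeasure_eq_AE) (auto elim!: eventually_mono)
  define \<alpha> \<beta> where "\<alpha> = measure lborel A" and "\<beta> = measure lborel B"
  have \<alpha>: "emeasure lborel A = ennreal \<alpha>" "\<alpha> > 0" and \<beta>: "emeasure lborel B = ennreal \<beta>" "\<beta> > 0"
  proof -
    have fin: "emeasure lborel A \<noteq> \<infinity>" "emeasure lborel B \<noteq> \<infinity>"
      using le1[OF Asub] le1[of B] by (auto simp: B_def top_unique)
    then show e: "emeasure lborel A = ennreal \<alpha>" "emeasure lborel B = ennreal \<beta>"
      by (simp_all add: \<alpha>_def \<beta>_def emeasure_eq_ennreal_measure)
    show "\<alpha> > 0" "\<beta> > 0" using nz e by (auto simp: B_def \<alpha>_def \<beta>_def zero_less_measure_iff)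
  qed
  obtain V where V: "open V" "A \<subseteq> V" "emeasure lborel (V - A) \<le> ennreal (\<beta> / 2)"
    using outer_regular_lborel_le[of A "\<beta> / 2"] \<beta> by auto
  define K where "K = unit_square - V"
  have K: "compact K"
  proof -
    have "compact unit_square" unfolding unit_square_def by (intro compact_Times) auto
    then show ?thesis unfolding K_def using V by (intro compact_diff) auto
  qed
  then have [measurable]: "K \<in> sets borel" by (rule borel_compact)
  have KQ: "emeasure lborel (K \<inter> open_square) = emeasure lborel K"
  proof (rule Q)
    show "K \<subseteq> unit_square" by (auto simp: K_def)
  qed measurable
  have KB: "K \<subseteq> B" using V by (auto simp: K_def B_def)
  have "ennreal \<beta> \<le> emeasure lborel (K \<union> (V - A))"
    unfolding \<beta>(1)[symmetric] by (rule emeasure_mono) (use V in \<open>auto simp: K_def B_def\<close>)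
  also have "\<dots> \<le> emeasure lborel K + emeasure lborel (V - A)"
    by (rule emeasure_subadditive) (use V in auto)
  also have "\<dots> \<le> emeasure lborel K + ennreal (\<beta> / 2)" using V by (intro add_left_mono)
  finally have Kge: "ennreal (\<beta> / 2) \<le> emeasure lborel K"
  proof -
    assume *: "ennreal \<beta> \<le> emeasure lborel K + ennreal (\<beta> / 2)"
    have "ennreal \<beta> = ennreal (\<beta> / 2) + ennreal (\<beta> / 2)" using \<beta> by (simp add: ennreal_plus[symmetric] del: ennreal_plus)
    then show ?thesis using * ennreal_add_left_cancel_le[of "ennreal (\<beta> / 2)"] by (simp add: add.commute)
  qed
  define \<epsilon> where "\<epsilon> = exp (- 8) * \<alpha> * (\<beta> / 2)"
  have \<epsilon>: "\<epsilon> > 0" using \<alpha> \<beta> by (simp add: \<epsilon>_def)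
  obtain U where U: "open U" "B \<subseteq> U" "emeasure lborel (U - B) < ennreal \<epsilon>"
    using outer_regular_lborel[of B \<epsilon>] \<epsilon> by auto
  have "ennreal \<epsilon> = ennreal (exp (- 8)) * ennreal \<alpha> * ennreal (\<beta> / 2)"
    using ennreal_mult[of "exp (- 8) * \<alpha>" "\<beta> / 2"] ennreal_mult[of "exp (- 8)" \<alpha>] \<alpha> \<beta>
    by (simp only: \<epsilon>_def) simp
  also have "\<dots> \<le> ennreal (exp (- 8)) * emeasure lborel (A \<inter> open_square) * emeasure lborel (K \<inter> open_square)"
    using Kge KQ Q[OF Asub] \<alpha> by (intro mult_mono) auto
  also have "\<dots> \<le> emeasure lborel (A \<inter> U \<inter> open_square)"
    by (rule invariant_mixing_bound[OF A K U(1)]) (use KB U in auto)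
  also have "\<dots> \<le> emeasure lborel (U - B)"
    by (rule emeasure_mono) (use U in \<open>auto simp: B_def\<close>)
  also have "\<dots> < ennreal \<epsilon>" by (rule U)
  finally show False by simp
qed

lemma inv_density_bounds:
  assumes "z \<in> unit_square"
  shows "3 / 4 \<le> inv_density z" "inv_density z \<le> 2"
proof -
  define t where "t = 1 / (1 + fst z)"
  have f: "0 \<le> fst z" "fst z \<le> 1" using assms by (auto simp: unit_square_def)
  then have t: "1 / 2 \<le> t" "t \<le> 1" by (auto simp: t_def field_simps)
  then have "(1 / 2)^2 \<le> t^2" "t^2 \<le> 1^2" by (intro power_mono; simp)+
  moreover have "inv_density z = t + t^2" by (simp add: inv_density_def t_def power_one_over)
  ultimately show "3 / 4 \<le> inv_density z" "inv_density z \<le> 2" using t by (auto simp: power2_eq_square)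
qed

section \<open>The invariant measure\<close>

theorem theorem2p6:
  shows "\<exists>\<mu> :: (real \<times> real) measure.
    sets \<mu> = sets lebesgue_square \<and>
    prob_space \<mu> \<and>
    absolutely_continuous lebesgue_square \<mu> \<and>
    absolutely_continuous \<mu> lebesgue_square \<and>
    preserves_measure T_fast \<mu> \<and>
    ergodic_wrt T_fast \<mu>"
proof -
  define h where "h z = ennreal (inv_density z)" for z
  have h [measurable]: "h \<in> borel_measurable borel"
    unfolding h_def[abs_def] inv_density_def by measurable
  define c where "c = (\<integral>\<^sup>+z. h z * indicator open_square z \<partial>lborel)"
  have sub: "z \<in> open_square \<Longrightarrow> z \<in> unit_square" for z by (auto simp: unit_square_def)
  have "ennreal (3 / 4) = (\<integral>\<^sup>+z. ennreal (3 / 4) * indicator open_square z \<partial>lborel)"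
    by (subst nn_integral_cmult_indicator) (auto simp: emeasure_square)
  also have "\<dots> \<le> c" unfolding c_def h_def
    by (intro nn_integral_mono)
      (use sub inv_density_bounds in \<open>auto split: split_indicator intro!: ennreal_leI\<close>)
  finally have c0: "c \<noteq> 0" by (auto simp: ennreal_eq_0_iff)
  have "c \<le> (\<integral>\<^sup>+z. ennreal 2 * indicator open_square z \<partial>lborel)" unfolding c_def h_def
    by (intro nn_integral_mono)
      (use sub inv_density_bounds in \<open>auto split: split_indicator intro!: ennreal_leI simp del: ennreal_numeral\<close>)
  also have "\<dots> = ennreal 2"
    by (subst nn_integral_cmult_indicator) (auto simp: emeasure_square)
  finally have c1: "c \<noteq> \<top>" by (auto simp: top_unique)
  define k where "k z = h z / c" for z
  have k [measurable]: "k \<in> borel_measurable borel" unfolding k_def[abs_def] by measurable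
  have k' [measurable]: "k \<in> borel_measurable lebesgue_square" by (rule measurable_lebesgue_square) fact
  have kpos: "k z > 0" if "z \<in> unit_square" for z
    using inv_density_bounds[OF that] c1
    by (simp add: k_def h_def zero_less_iff_neq_zero ennreal_divide_eq_0_iff ennreal_eq_0_iff)
  define \<mu> where "\<mu> = density lebesgue_square k"
  have sets: "sets \<mu> = sets lebesgue_square" and space: "space \<mu> = unit_square"
    by (simp_all add: \<mu>_def space_lebesgue_square)
  have emeasure: "emeasure \<mu> A = (\<integral>\<^sup>+z. (indicator A z * h z) * indicator open_square z \<partial>lborel) / c"
    if "A \<in> sets \<mu>" for A
  proof -
    have A: "A \<in> sets lebesgue_square" using that sets by simp
    then have [measurable]: "A \<in> sets borel" by (simp add: sets_lebesgue_square)
    have "emeasure \<mu> A = (\<integral>\<^sup>+z. (k z * indicator A z) * indicator open_square z \<partial>lborel)"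
      unfolding \<mu>_def using A by (simp add: emeasure_density nn_integral_lebesgue_square)
    also have "\<dots> = (\<integral>\<^sup>+z. (indicator A z * h z) * indicator open_square z / c \<partial>lborel)"
      by (intro nn_integral_cong) (simp add: k_def divide_ennreal_def ac_simps)
    also have "\<dots> = (\<integral>\<^sup>+z. (indicator A z * h z) * indicator open_square z \<partial>lborel) / c"
      by (rule nn_integral_divide) measurable
    finally show ?thesis .
  qed
  have "prob_space \<mu>"
  proof
    have "unit_square \<in> sets \<mu>" using sets.top[of \<mu>] space by simp
    then have "emeasure \<mu> unit_square = (\<integral>\<^sup>+z. (indicator unit_square z * h z) * indicator open_square z \<partial>lborel) / c"
      by (rule emeasure)
    also have "(\<integral>\<^sup>+z. (indicator unit_square z * h z) * indicator open_square z \<partial>lborel) = c"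
      unfolding c_def
      by (intro nn_integral_cong) (use sub in \<open>auto split: split_indicator\<close>)
    finally show "emeasure \<mu> (space \<mu>) = 1" using c0 c1 space by (simp add: ennreal_divide_self less_top)
  qed
  moreover have ac1: "absolutely_continuous lebesgue_square \<mu>"
    unfolding \<mu>_def by (rule absolutely_continuousI_density) fact
  moreover have ac2: "absolutely_continuous \<mu> lebesgue_square"
    unfolding absolutely_continuous_def
  proof
    fix A assume "A \<in> null_sets \<mu>"
    then have A: "A \<in> sets lebesgue_square" "AE z in lebesgue_square. z \<in> A \<longrightarrow> k z = 0"
      unfolding \<mu>_def using k' by (auto simp: null_sets_density_iff)
    have "AE z in lebesgue_square. z \<notin> A"
      using A(2) AE_space
      by eventually_elim (use kpos in \<open>force simp: space_lebesgue_square\<close>)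
    then show "A \<in> null_sets lebesgue_square" using A(1) by (simp add: AE_iff_null_sets)
  qed
  moreover have "preserves_measure T_fast \<mu>"
    unfolding preserves_measure_def
  proof (intro conjI ballI)
    have "T_fast \<in> measurable lebesgue_square lebesgue_square"
      unfolding lebesgue_square_def
      by (intro measurable_restrict_space3) (auto simp: T_fast_in_unit_square)
    then show T: "T_fast \<in> measurable \<mu> \<mu>" using sets by (simp cong: measurable_cong_sets)
    fix A assume A: "A \<in> sets \<mu>"
    then have [measurable]: "A \<in> sets borel" by (simp add: sets sets_lebesgue_square)
    have "emeasure \<mu> (T_fast -` A \<inter> space \<mu>) =
        (\<integral>\<^sup>+z. (indicator (T_fast -` A \<inter> space \<mu>) z * h z) * indicator open_square z \<partial>lborel) / c"
      by (rule emeasure) (rule measurable_sets[OF T A])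
    also have "(\<integral>\<^sup>+z. (indicator (T_fast -` A \<inter> space \<mu>) z * h z) * indicator open_square z \<partial>lborel) =
        (\<integral>\<^sup>+z. (indicator A (T_fast z) * h z) * indicator open_square z \<partial>lborel)"
      by (intro nn_integral_cong) (use sub space in \<open>auto split: split_indicator\<close>)
    also have "\<dots> = (\<integral>\<^sup>+z. (indicator A z * transfer h z) * indicator open_square z \<partial>lborel)"
      by (rule nn_integral_koopman) measurable
    also have "\<dots> = (\<integral>\<^sup>+z. (indicator A z * h z) * indicator open_square z \<partial>lborel)"
      by (intro nn_integral_cong)
        (use transfer_inv_density in \<open>auto split: split_indicator simp: h_def[abs_def]\<close>)
    also have "\<dots> / c = emeasure \<mu> A" using emeasure[OF A] by simp
    finally show "emeasure \<mu> (T_fast -` A \<inter> space \<mu>) = emeasure \<mu> A" .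
  qed
  moreover have "ergodic_wrt T_fast \<mu>"
    unfolding ergodic_wrt_def
  proof (intro ballI impI)
    fix A assume A: "A \<in> sets \<mu>" "T_fast -` A \<inter> space \<mu> = A"
    then have Ab: "A \<in> sets borel" "A \<subseteq> unit_square" by (auto simp: sets sets_lebesgue_square)
    have null: "C \<in> null_sets \<mu>" if "C \<in> sets borel" "C \<subseteq> unit_square" "emeasure lborel C = 0" for C
    proof -
      have "C \<in> null_sets lebesgue_square"
        unfolding lebesgue_square_def using that by (subst null_sets_restrict_space) auto
      then show ?thesis using ac1 unfolding absolutely_continuous_def by blast
    qed
    show "A \<in> null_sets \<mu> \<or> space \<mu> - A \<in> null_sets \<mu>"
      using invariant_set_trivial[OF Ab(1)] A(2) space null[OF Ab] null[of "unit_square - A"] Ab by auto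
  qed
  ultimately show ?thesis using sets by blast
qed

end
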